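(* For any non-negative integer $k$ and every integer $n\ge 0$, the following congruences hold: \begin{itemize} \item[(i)] $p_{7k+1}(7n+5)\equiv 0 \pmod 7$. \item[(ii)] $p_{7k+4}(7n+j)\equiv 0 \pmod 7$ for $j=2,4,5,6$. \item[(iii)] $p_{7k+6}(7n+j)\equiv 0 \pmod 7$ for $j=3,4,6$. \item[(iv)] $p_{49k+2}(49n+7j+3)\equiv 0 \pmod 7$ for $j=2,4,5,6$. \item[(v)] $p_{49k+3}(49n+7j+1)\equiv 0 \pmod 7$ for $j=2,4,5,6$. \item[(vi)] $p_{49k+5}(49n+39)\equiv 0 \pmod 7$. \end{itemize}
   Context: For a positive integer $r$, $p_r(n)$ denotes the number of $r$-colour partitions of $n$, i.e. the number of partitions of $n$ in which each part is available in $r$ distinct colours (there are $r$ copies of each part size, all viewed as distinct objects; the order of parts is irrelevant). Equivalently, $p_r(n)$ is defined by the generating function $$\sum_{n=0}^{\infty}p_r(n)q^n=\frac{1}{(q;q)_\infty^{r}},\qquad (a;q)_\infty=\prod_{n=0}^{\infty}(1-aq^n),$$ so that $p_r(0)=1$. *)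

theory Defs
  imports Complex_Main "HOL-Library.Multiset" "HOL-Number_Theory.Cong"
begin

text \<open>
  A coloured part is a pair \<open>(a, c)\<close> of a part size \<open>a \<ge> 1\<close> and a colour \<open>c < r\<close>;
  an \<open>r\<close>-colour partition of \<open>n\<close> is a finite multiset of coloured parts whose sizes
  add up to \<open>n\<close>.
\<close>

definition colour_partitions :: "nat \<Rightarrow> nat \<Rightarrow> (nat \<times> nat) multiset set" where
  "colour_partitions r n =
     {M. (\<forall>(a, c) \<in> set_mset M. a \<ge> 1 \<and> c < r) \<and> (\<Sum>(a, c) \<in># M. a) = n}"

definition num_colour_partitions :: "nat \<Rightarrow> nat \<Rightarrow> nat" where
  "num_colour_partitions r n = card (colour_partitions r n)"

text \<open>The set being counted is finite, so \<open>card\<close> does not degenerate to \<open>0\<close>.\<close>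

lemma finite_colour_partitions: "finite (colour_partitions r n)"
proof (rule finite_subset)
  let ?A = "{1..n} \<times> {..<r}"
  show "colour_partitions r n \<subseteq> (\<Union>s\<le>n. {M. size M = s \<and> set_mset M \<subseteq> ?A})"
  proof
    fix M assume M: "M \<in> colour_partitions r n"
    then have parts: "\<forall>x \<in># M. fst x \<ge> 1 \<and> snd x < r"
      and sum: "(\<Sum>x \<in># M. fst x) = n"
      by (auto simp: colour_partitions_def case_prod_unfold)
    have "size M = (\<Sum>x \<in># M. 1)"
      by (rule size_eq_sum_mset)
    also have "\<dots> \<le> (\<Sum>x \<in># M. fst x)"
      using parts by (intro sum_mset_mono) blast
    finally have "size M \<le> n"
      using sum by simp
    moreover have "set_mset M \<subseteq> ?A"
    proof
      fix x assume x: "x \<in># M"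
      then have "fst x \<le> (\<Sum>x \<in># M. fst x)"
        using multi_member_split by fastforce
      with x parts sum show "x \<in> ?A"
        by (cases x) auto
    qed
    ultimately show "M \<in> (\<Union>s\<le>n. {M. size M = s \<and> set_mset M \<subseteq> ?A})"
      by auto
  qed
  have "finite {M. size M = s \<and> set_mset M \<subseteq> ?A}" for s
  proof (rule finite_subset)
    show "{M. size M = s \<and> set_mset M \<subseteq> ?A}
            \<subseteq> mset ` {xs. set xs \<subseteq> ?A \<and> length xs = s}"
    proof
      fix M assume "M \<in> {M. size M = s \<and> set_mset M \<subseteq> ?A}"
      moreover obtain xs where "M = mset xs"
        using ex_mset[of M] by blast
      ultimately show "M \<in> mset ` {xs. set xs \<subseteq> ?A \<and> length xs = s}"
        by auto
    qed
    show "finite (mset ` {xs. set xs \<subseteq> ?A \<and> length xs = s})"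
      by (intro finite_imageI finite_lists_length_eq) auto
  qed
  then show "finite (\<Union>s\<le>n. {M. size M = s \<and> set_mset M \<subseteq> ?A})"
    by auto
qed

end

theory Submission
  imports
    Defs
    "HOL-Computational_Algebra.Formal_Power_Series"
    "HOL-Library.Numeral_Type"
    "HOL-Library.Nat_Bijection"
begin

text \<open>Write \<open>E\<close> for Euler's product \<open>(q;q)_\<infinity>\<close>, so that \<open>\<Sum> p_r(n) q^n = E^(-r)\<close>, and work with power series over
the field with seven elements, where \<open>f(q)^7 = f(q^7)\<close>. Then \<open>E^(-r)\<close> is \<open>E^e\<close> times a series in \<open>q^7\<close>
whenever \<open>r + e\<close> is a multiple of \<open>7\<close>, and multiplication by a series in \<open>q^7\<close> creates no new exponents
modulo \<open>7\<close>.

For \<open>r = 7k + 1\<close>, \<open>7k + 4\<close>, \<open>7k + 6\<close> this leaves \<open>E^6\<close>, \<open>E^3\<close>, \<open>E\<close>. By the pentagonal number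
theorem the exponents in \<open>E\<close> are \<open>0, 1, 2, 5\<close> modulo \<open>7\<close> (\<open>residues_in_euler\<close>). By Jacobi's identity
\<open>E^3 = \<Sum> (-1)^j (2j+1) q^(j(j+1)/2)\<close> the exponents in \<open>E^3\<close> are \<open>0, 1, 3\<close> (\<open>residues_in_euler_cube\<close>),
so \<open>E^6 = (E^3)^2\<close> has none congruent to \<open>5\<close>. This settles these three values of \<open>r\<close>.

For \<open>r = 49k + s\<close> with \<open>s = 2, 3, 5\<close> the series is \<open>E^(7-s)\<close> times the sixth power of \<open>E(q^7)\<close> and a series in
\<open>q^49\<close>. One first extracts the coefficients at \<open>7m + 3\<close>, \<open>7m + 1\<close>, \<open>7m + 4\<close> respectively. The key fact
(\<open>extract7_euler_powers\<close>) is that this turns \<open>E^5\<close>, \<open>E^4\<close>, \<open>E^2\<close> into \<open>3 E^11\<close>, \<open>-4 E^4\<close>, \<open>E^14\<close>.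
Together with the factor \<open>E^6\<close> this gives the exponents \<open>17\<close>, \<open>10\<close>, \<open>20\<close>, which are \<open>3, 3, 6\<close> modulo \<open>7\<close>,
and the previous argument applies once more.

The key fact is a purely algebraic consequence of the two theta identities. Split \<open>E = a + b + c + d\<close>
according to the exponents \<open>0, 1, 2, 5\<close> modulo \<open>7\<close>. The pentagonal numbers congruent to \<open>2\<close> are \<open>49\<close> times
pentagonal numbers plus \<open>2\<close>, whence \<open>c = -q^2 E(q^49)\<close>. The classes missing from \<open>E^3\<close> give four polynomial
relations between \<open>a, b, c, d\<close> (\<open>dissection_of_euler\<close>), and modulo these the required sections of \<open>E^4\<close> and \<open>E^5\<close>
are determined (\<open>octic_identity\<close>, \<open>quintic_identity\<close>).

The pentagonal number theorem is proved through Shanks' finite identity, Jacobi's identity by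
differentiating the \<open>q\<close>-binomial theorem.\<close>

unbundle fps_syntax

section \<open>Power series modulo a power of the variable\<close>

definition trunc_eq :: "nat \<Rightarrow> 'a::comm_ring_1 fps \<Rightarrow> 'a fps \<Rightarrow> bool" where
  "trunc_eq n f g \<longleftrightarrow> (\<forall>i<n. f $ i = g $ i)"

lemma trunc_eq_refl [simp]: "trunc_eq n f f"
  by (simp add: trunc_eq_def)

lemma trunc_eq_sym: "trunc_eq n f g \<Longrightarrow> trunc_eq n g f"
  by (simp add: trunc_eq_def)

lemma trunc_eq_trans [trans]: "trunc_eq n f g \<Longrightarrow> trunc_eq n g h \<Longrightarrow> trunc_eq n f h"
  by (simp add: trunc_eq_def)

lemma trunc_eq_mono: "trunc_eq n f g \<Longrightarrow> m \<le> n \<Longrightarrow> trunc_eq m f g"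
  by (simp add: trunc_eq_def)

lemma trunc_eq_mult: "trunc_eq n f g \<Longrightarrow> trunc_eq n f' g' \<Longrightarrow> trunc_eq n (f * f') (g * g')"
  by (auto simp: trunc_eq_def fps_mult_nth intro!: sum.cong)

lemma trunc_eq_add: "trunc_eq n f g \<Longrightarrow> trunc_eq n f' g' \<Longrightarrow> trunc_eq n (f + f') (g + g')"
  by (simp add: trunc_eq_def)

lemma trunc_eq_diff: "trunc_eq n f g \<Longrightarrow> trunc_eq n f' g' \<Longrightarrow> trunc_eq n (f - f') (g - g')"
  by (simp add: trunc_eq_def)

lemma trunc_eq_power: "trunc_eq n f g \<Longrightarrow> trunc_eq n (f ^ r) (g ^ r)"
  by (induction r) (auto intro: trunc_eq_mult)

lemma trunc_eq_sum: "(\<And>k. k \<in> A \<Longrightarrow> trunc_eq n (f k) (g k)) \<Longrightarrow> trunc_eq n (sum f A) (sum g A)"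
  by (simp add: trunc_eq_def fps_sum_nth)

lemma trunc_eq_X_power_mult:
  "trunc_eq m f g \<Longrightarrow> n \<le> k + m \<Longrightarrow> trunc_eq n (fps_X ^ k * f) (fps_X ^ k * g)"
  by (auto simp: trunc_eq_def fps_X_power_mult_nth)

lemma fps_eqI_trunc_eq: "(\<And>n. trunc_eq n f g) \<Longrightarrow> f = g"
  by (auto simp: trunc_eq_def fps_eq_iff)

lemma fps_X_power_mult_cancel:
  fixes f g :: "'a::comm_ring_1 fps"
  assumes "fps_X ^ k * f = fps_X ^ k * g"
  shows "f = g"
proof (rule fps_ext)
  fix n :: nat
  have "(fps_X ^ k * f) $ (n + k) = (fps_X ^ k * g) $ (n + k)"
    using assms by simp
  then show "f $ n = g $ n"
    by (simp add: fps_X_power_mult_nth)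
qed

section \<open>Euler's product\<close>

definition euler_poly :: "nat \<Rightarrow> 'a::comm_ring_1 fps" where
  "euler_poly n = (\<Prod>i\<in>{1..n}. 1 - fps_X ^ i)"

text \<open>The infinite product. Its \<open>n\<close>-th coefficient is read off the first \<open>n\<close> factors, since the
later factors are \<open>1\<close> modulo \<open>q^(n+1)\<close>.\<close>

definition euler :: "'a::comm_ring_1 fps" where
  "euler = Abs_fps (\<lambda>n. euler_poly n $ n)"

lemma euler_poly_0 [simp]: "euler_poly 0 = 1"
  by (simp add: euler_poly_def)

lemma euler_poly_Suc: "euler_poly (Suc n) = euler_poly n * (1 - fps_X ^ Suc n)"
  by (simp add: euler_poly_def)

lemma trunc_eq_one_minus_X_power: "n \<le> k \<Longrightarrow> trunc_eq n (1 - fps_X ^ k) 1"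
  by (simp add: trunc_eq_def)

lemma euler_poly_stable:
  assumes "m \<le> n"
  shows "trunc_eq (Suc m) (euler_poly n) (euler_poly m :: 'a::comm_ring_1 fps)"
  using assms
proof (induction n rule: dec_induct)
  case (step n)
  have "trunc_eq (Suc m) (euler_poly n * (1 - fps_X ^ Suc n)) (euler_poly m * 1 :: 'a fps)"
    using step by (intro trunc_eq_mult trunc_eq_one_minus_X_power) auto
  then show ?case by (simp add: euler_poly_Suc)
qed simp

lemma trunc_eq_euler: "trunc_eq (Suc n) euler (euler_poly n)"
  by (simp add: trunc_eq_def euler_def less_Suc_eq_le)
    (metis euler_poly_stable trunc_eq_def lessI)

lemma trunc_eq_euler': "m \<le> n \<Longrightarrow> trunc_eq (Suc m) (euler_poly n) euler"
  by (meson trunc_eq_trans trunc_eq_sym trunc_eq_euler euler_poly_stable)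

section \<open>The generating function of coloured partitions\<close>

text \<open>The generating function is found by admitting one coloured part at a time, so partitions are
counted relative to the set \<open>A\<close> of admitted coloured parts.\<close>

definition partitions_into :: "(nat \<times> nat) set \<Rightarrow> nat \<Rightarrow> (nat \<times> nat) multiset set" where
  "partitions_into A n = {M. set_mset M \<subseteq> A \<and> (\<Sum>x\<in>#M. fst x) = n}"

lemma colour_partitions_eq:
  "colour_partitions r n = partitions_into ({1..} \<times> {..<r}) n"
  by (auto simp: colour_partitions_def partitions_into_def case_prod_unfold)

lemma partitions_into_bounded:
  "partitions_into ({1..} \<times> {..<r}) n = partitions_into ({1..n} \<times> {..<r}) n"
proof -
  have "fst x \<le> (\<Sum>x\<in>#M. fst x)" if "x \<in># M" for x and M :: "(nat \<times> nat) multiset"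
    using that multi_member_split by fastforce
  then show ?thesis
    unfolding partitions_into_def by (intro Collect_cong) (auto simp: subset_iff mem_Times_iff)
qed

lemma partitions_into_mono: "A \<subseteq> B \<Longrightarrow> partitions_into A n \<subseteq> partitions_into B n"
  by (auto simp: partitions_into_def)

lemma finite_partitions_into:
  assumes "A \<subseteq> {1..} \<times> {..<r}"
  shows "finite (partitions_into A n)"
proof (rule finite_subset)
  show "partitions_into A n \<subseteq> colour_partitions r n"
    using assms by (auto simp: colour_partitions_eq partitions_into_def)
qed (rule finite_colour_partitions)

text \<open>A partition either avoids the new part \<open>x\<close>, or arises from a unique smaller partition by adding
one copy of \<open>x\<close>. In terms of generating functions: multiplying by \<open>1 - q^|x|\<close> removes \<open>x\<close> from the
admitted parts.\<close>

lemma card_partitions_into_insert: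
  assumes "insert x A \<subseteq> {1..} \<times> {..<r}" "x \<notin> A"
  shows "card (partitions_into (insert x A) n) = card (partitions_into A n) +
    (if fst x \<le> n then card (partitions_into (insert x A) (n - fst x)) else 0)"
proof -
  define B where "B = {M \<in> partitions_into (insert x A) n. x \<in># M}"
  have split: "partitions_into (insert x A) n = partitions_into A n \<union> B"
    using assms(2) by (auto simp: partitions_into_def B_def)
  have "finite (partitions_into A n)" "finite B"
    using assms(1) finite_partitions_into[of "insert x A" r n] finite_partitions_into[of A r n]
    by (auto simp: B_def)
  moreover have "partitions_into A n \<inter> B = {}"
    using assms(2) by (auto simp: partitions_into_def B_def)
  ultimately have "card (partitions_into (insert x A) n) = card (partitions_into A n) + card B"
    by (simp add: split card_Un_disjoint)
  moreover have "B = (if fst x \<le> n then add_mset x ` partitions_into (insert x A) (n - fst x) else {})"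
  proof -
    have "M \<in> B \<longleftrightarrow> fst x \<le> n \<and> M \<in> add_mset x ` partitions_into (insert x A) (n - fst x)" for M
    proof
      assume M: "M \<in> B"
      then obtain N where "M = add_mset x N"
        by (auto simp: B_def dest: multi_member_split)
      with M show "fst x \<le> n \<and> M \<in> add_mset x ` partitions_into (insert x A) (n - fst x)"
        by (auto simp: B_def partitions_into_def)
    qed (auto simp: B_def partitions_into_def)
    then show ?thesis by (auto simp del: image_iff)
  qed
  then have "card B = (if fst x \<le> n then card (partitions_into (insert x A) (n - fst x)) else 0)"
    by (auto simp: card_image inj_on_def)
  ultimately show ?thesis by simp
qed

definition partitions_into_fps :: "(nat \<times> nat) set \<Rightarrow> 'a::comm_ring_1 fps" where
  "partitions_into_fps A = Abs_fps (\<lambda>n. of_nat (card (partitions_into A n)))"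

lemma partitions_into_fps_mult:
  assumes "finite A" "A \<subseteq> {1..} \<times> {..<r}"
  shows "partitions_into_fps A * (\<Prod>x\<in>A. 1 - fps_X ^ fst x) = (1 :: 'a::comm_ring_1 fps)"
  using assms
proof (induction A)
  case empty
  have "partitions_into {} n = (if n = 0 then {{#}} else {})" for n
    by (auto simp: partitions_into_def)
  then show ?case
    by (simp add: partitions_into_fps_def fps_eq_iff)
next
  case (insert x A)
  have "partitions_into_fps (insert x A) * (1 - fps_X ^ fst x) = (partitions_into_fps A :: 'a fps)"
    by (rule fps_ext) (auto simp: partitions_into_fps_def right_diff_distrib fps_X_power_mult_right_nth
      card_partitions_into_insert[OF insert.prems insert.hyps(2)])
  then show ?case
    using insert by (simp add: mult.assoc[symmetric])
qed

definition colour_partitions_fps :: "nat \<Rightarrow> 'a::comm_ring_1 fps" where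
  "colour_partitions_fps r = Abs_fps (\<lambda>n. of_nat (num_colour_partitions r n))"

text \<open>Up to any given degree only finitely many coloured parts matter, and for those the product of
the factors \<open>1 - q^|x|\<close> is the \<open>r\<close>-th power of a partial product of Euler's product.\<close>

theorem colour_partitions_fps_mult_euler:
  "colour_partitions_fps r * euler ^ r = (1 :: 'a::comm_ring_1 fps)"
proof (rule fps_eqI_trunc_eq)
  fix n :: nat
  let ?A = "{1..n} \<times> {..<r}"
  have "num_colour_partitions r i = card (partitions_into ?A i)" if "i < n" for i :: nat
  proof -
    have "partitions_into ({1..i} \<times> {..<r}) i \<subseteq> partitions_into ?A i"
         "partitions_into ?A i \<subseteq> partitions_into ({1..} \<times> {..<r}) i"
      using that by (intro partitions_into_mono; fastforce)+
    then show ?thesis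
      unfolding num_colour_partitions_def colour_partitions_eq partitions_into_bounded[of r i]
      by (metis subset_antisym)
  qed
  then have "trunc_eq n (colour_partitions_fps r) (partitions_into_fps ?A :: 'a fps)"
    by (simp add: trunc_eq_def colour_partitions_fps_def partitions_into_fps_def)
  moreover have "trunc_eq n (euler ^ r) (euler_poly n ^ r :: 'a fps)"
    by (intro trunc_eq_power trunc_eq_mono[OF trunc_eq_euler]) simp
  ultimately have "trunc_eq n (colour_partitions_fps r * euler ^ r)
      (partitions_into_fps ?A * euler_poly n ^ r :: 'a fps)"
    by (rule trunc_eq_mult)
  also have "euler_poly n ^ r = (\<Prod>x\<in>?A. 1 - fps_X ^ fst x :: 'a fps)"
    by (simp add: euler_poly_def prod.cartesian_product' prod_power_distrib)
  also have "partitions_into_fps ?A * \<dots> = 1"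
    by (rule partitions_into_fps_mult[where r = r]) auto
  finally show "trunc_eq n (colour_partitions_fps r * euler ^ r) (1 :: 'a fps)" .
qed

section \<open>Euler's pentagonal number theorem\<close>

lemma triangle_double: "2 * triangle n = n * Suc n"
  by (simp add: triangle_def)

lemma le_triangle: "n \<le> triangle n"
  by (induction n) auto

text \<open>Shanks' summands \<open>(-1)^k q^(kn + k(k+1)/2) (q;q)_n / (q;q)_k\<close>; the quotient is written as a product
to avoid division. The summand for \<open>k = 0\<close> is the partial product of Euler's product, all others are
divisible by \<open>q^(n+1)\<close>.\<close>

definition shanks_term :: "nat \<Rightarrow> nat \<Rightarrow> 'a::comm_ring_1 fps" where
  "shanks_term n k = (-1) ^ k * fps_X ^ (k * n + triangle k) * (\<Prod>i\<in>{k<..n}. 1 - fps_X ^ i)"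

lemma prod_greaterThanAtMost_first:
  fixes f :: "nat \<Rightarrow> 'a::comm_monoid_mult"
  shows "m < n \<Longrightarrow> (\<Prod>i\<in>{m<..n}. f i) = f (Suc m) * (\<Prod>i\<in>{Suc m<..n}. f i)"
proof -
  assume "m < n"
  then have "{m<..n} = insert (Suc m) {Suc m<..n}" by auto
  then show ?thesis by simp
qed

text \<open>Passing from \<open>n\<close> to \<open>n + 1\<close>, the differences of the summands telescope over \<open>k\<close>: the part of the
\<open>k\<close>-th difference that carries \<open>1 - q^k\<close> cancels the boundary term left by the first \<open>k\<close> summands.\<close>

lemma shanks_telescope:
  "m \<le> n \<Longrightarrow> (\<Sum>k\<le>m. shanks_term (Suc n) k - shanks_term n k) =
     - ((-1) ^ m * fps_X ^ (Suc m * Suc n + triangle m) * (\<Prod>i\<in>{m<..n}. 1 - fps_X ^ i) :: 'a::comm_ring_1 fps)"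
proof (induction m)
  case 0
  have "{0<..Suc n} = insert (Suc n) {0<..n}" by auto
  then show ?case by (simp add: shanks_term_def algebra_simps)
next
  case (Suc m)
  define R :: "'a fps" where "R = (\<Prod>i\<in>{Suc m<..n}. 1 - fps_X ^ i)"
  have R1: "(\<Prod>i\<in>{m<..n}. 1 - fps_X ^ i) = (1 - fps_X ^ Suc m) * R"
    unfolding R_def using Suc.prems by (intro prod_greaterThanAtMost_first) simp
  have "{Suc m<..Suc n} = insert (Suc n) {Suc m<..n}" using Suc.prems by auto
  then have R2: "(\<Prod>i\<in>{Suc m<..Suc n}. 1 - fps_X ^ i) = (1 - fps_X ^ Suc n) * R"
    by (simp add: R_def)
  define p :: "'a fps" where "p = fps_X ^ (m * n + triangle m + n)"
  define u :: "'a fps" where "u = fps_X ^ Suc m"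
  define v :: "'a fps" where "v = fps_X ^ Suc n"
  have e: "fps_X ^ (Suc m * Suc n + triangle m) = p * u"
    "fps_X ^ (Suc m * Suc n + triangle (Suc m)) = p * u * u"
    "fps_X ^ (Suc m * n + triangle (Suc m)) = p * u"
    "fps_X ^ (Suc (Suc m) * Suc n + triangle (Suc m)) = p * u * u * v"
    unfolding p_def u_def v_def power_add[symmetric] by (rule arg_cong[where f = "(^) _"], simp)+
  show ?case
    using Suc unfolding sum.atMost_Suc shanks_term_def R_def[symmetric] R1 R2 e u_def[symmetric] v_def[symmetric]
    by (simp add: algebra_simps)
qed

lemma sum_shanks_term_Suc:
  "(\<Sum>k\<le>Suc n. shanks_term (Suc n) k) = (\<Sum>k\<le>n. shanks_term n k) +
     (-1) ^ Suc n * (fps_X ^ (Suc n * Suc n + triangle n) + fps_X ^ (Suc n * Suc n + triangle (Suc n)) 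
        :: 'a::comm_ring_1 fps)"
proof -
  have "(\<Sum>k\<le>n. shanks_term (Suc n) k) - (\<Sum>k\<le>n. shanks_term n k) =
     (- ((-1) ^ n * fps_X ^ (Suc n * Suc n + triangle n)) :: 'a fps)"
    using shanks_telescope[of n n] by (simp add: sum_subtractf)
  then show ?thesis
    by (simp add: shanks_term_def algebra_simps)
qed

text \<open>The exponents \<open>k^2 + k(k+1)/2\<close> and \<open>(k+1)^2 + k(k+1)/2\<close> are the generalized pentagonal numbers
\<open>j(3j+1)/2\<close> for \<open>j = k \<ge> 0\<close> and for \<open>j = -(k+1) < 0\<close>. Each step of the induction contributes the two
boundary terms of the telescoping sum, which are the two new pentagonal powers.\<close>

lemma shanks_identity:
  "(\<Sum>k\<le>n. shanks_term n k) =
    ((\<Sum>k\<le>n. (-1) ^ k * fps_X ^ (k * k + triangle k)) -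
     (\<Sum>k<n. (-1) ^ k * fps_X ^ (Suc k * Suc k + triangle k)) :: 'a::comm_ring_1 fps)"
proof (induction n)
  case 0
  show ?case by (simp add: shanks_term_def)
next
  case (Suc n)
  show ?case
    unfolding sum_shanks_term_Suc Suc.IH by (simp add: algebra_simps)
qed

theorem pentagonal_number_trunc:
  "trunc_eq (Suc n) euler
    ((\<Sum>k\<le>n. (-1) ^ k * fps_X ^ (k * k + triangle k)) -
     (\<Sum>k<n. (-1) ^ k * fps_X ^ (Suc k * Suc k + triangle k)) :: 'a::comm_ring_1 fps)"
proof -
  have "trunc_eq (Suc n) (shanks_term n k) (0 :: 'a fps)" if "0 < k" for k
  proof -
    have "Suc n \<le> k * n + triangle k"
      using that le_triangle[of k] by (cases k) auto
    then show ?thesis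
      by (auto simp: trunc_eq_def shanks_term_def mult.assoc fps_X_power_mult_nth
          mult.left_commute[of _ "fps_X ^ _"])
  qed
  then have "trunc_eq (Suc n) (\<Sum>k\<le>n. shanks_term n k) (\<Sum>k\<le>n. if k = 0 then shanks_term n 0 else (0 :: 'a fps))"
    by (intro trunc_eq_sum) auto
  moreover have "shanks_term n 0 = (euler_poly n :: 'a fps)"
    by (auto simp: shanks_term_def euler_poly_def intro!: prod.cong)
  ultimately have "trunc_eq (Suc n) (\<Sum>k\<le>n. shanks_term n k) (euler_poly n :: 'a fps)"
    by simp
  then show ?thesis
    unfolding shanks_identity by (meson trunc_eq_euler trunc_eq_sym trunc_eq_trans)
qed

section \<open>Jacobi's identity for the cube of Euler's product\<close>

fun qbinomial :: "nat \<Rightarrow> nat \<Rightarrow> 'a::comm_ring_1 fps" where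
  "qbinomial n 0 = 1"
| "qbinomial 0 (Suc k) = 0"
| "qbinomial (Suc n) (Suc k) = qbinomial n (Suc k) + fps_X ^ (n - k) * qbinomial n k"

lemma qbinomial_eq_0: "n < k \<Longrightarrow> qbinomial n k = 0"
  by (induction n k rule: qbinomial.induct) auto

lemma qbinomial_mult_euler_poly:
  "k \<le> n \<Longrightarrow> euler_poly k * euler_poly (n - k) * qbinomial n k = (euler_poly n :: 'a::comm_ring_1 fps)"
proof (induction n k rule: qbinomial.induct)
  case (3 n k)
  define u :: "'a fps" where "u = fps_X ^ Suc k"
  define v :: "'a fps" where "v = fps_X ^ (n - k)"
  have uv: "fps_X ^ Suc n = u * v"
    using 3(3) by (simp add: u_def v_def flip: power_add power_Suc)
  have Q: "euler_poly k * euler_poly (n - k) * qbinomial n k = (euler_poly n :: 'a fps)"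
    using 3 by simp
  have P: "euler_poly (Suc k) * euler_poly (n - k) * qbinomial n (Suc k) = (1 - v) * (euler_poly n :: 'a fps)"
  proof (cases "k = n")
    case False
    then have "euler_poly (n - k) = euler_poly (n - Suc k) * (1 - v)"
      using 3(3) euler_poly_Suc[of "n - Suc k", where ?'a = 'a] by (simp add: v_def Suc_diff_Suc)
    then have "euler_poly (Suc k) * euler_poly (n - k) * qbinomial n (Suc k) =
       (1 - v) * (euler_poly (Suc k) * euler_poly (n - Suc k) * qbinomial n (Suc k))"
      by (simp only: mult_ac)
    then show ?thesis using 3(1,3) False by simp
  qed (simp add: v_def qbinomial_eq_0)
  have "euler_poly (Suc k) * euler_poly (Suc n - Suc k) * qbinomial (Suc n) (Suc k) =
    euler_poly (Suc k) * euler_poly (n - k) * qbinomial n (Suc k) +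
    v * (1 - u) * (euler_poly k * euler_poly (n - k) * qbinomial n k)"
    by (simp add: euler_poly_Suc u_def v_def algebra_simps)
  also have "\<dots> = euler_poly n * (1 - u * v)"
    unfolding P Q by (simp add: algebra_simps)
  finally show ?case by (simp add: euler_poly_Suc uv flip: power_Suc)
qed simp_all

text \<open>Summands of the expansion of \<open>(y + x)(y + qx)...(y + q^(n-1) x)\<close> in the \<open>q\<close>-binomial theorem.
The truncated \<open>k - 1\<close> is harmless: the exponent \<open>k(k-1)/2\<close> is \<open>0\<close> at \<open>k = 0\<close> as well.\<close>

definition qbin_term :: "'a::comm_ring_1 fps \<Rightarrow> 'a fps \<Rightarrow> nat \<Rightarrow> nat \<Rightarrow> 'a fps" where
  "qbin_term x y n k = qbinomial n k * fps_X ^ triangle (k - 1) * x ^ k * y ^ (n - k)"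

text \<open>One new factor \<open>y + q^n x\<close>, seen through an arbitrary weight \<open>w\<close> on the powers of \<open>x\<close>. The weight
\<open>1\<close> gives the \<open>q\<close>-binomial theorem, the weight \<open>k\<close> its derivative with respect to \<open>x\<close>.\<close>

lemma sum_qbin_term_Suc:
  "(\<Sum>k\<le>Suc n. w k * qbin_term x y (Suc n) k) =
     y * (\<Sum>k\<le>n. w k * qbin_term x y n k) + x * fps_X ^ n * (\<Sum>k\<le>n. w (Suc k) * qbin_term x y n k)"
proof -
  have t: "qbin_term x y (Suc n) (Suc k) = y * qbin_term x y n (Suc k) + x * fps_X ^ n * qbin_term x y n k"
    if "k \<le> n" for k
  proof -
    have "triangle k = triangle (k - 1) + k" by (cases k) auto
    then have e: "fps_X ^ triangle k * fps_X ^ (n - k) = (fps_X ^ n * fps_X ^ triangle (k - 1) :: 'a fps)"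
      using that by (simp flip: power_add)
    have "qbin_term x y (Suc n) (Suc k) = qbinomial n (Suc k) * fps_X ^ triangle k * x ^ Suc k * y ^ (n - k)
       + (fps_X ^ triangle k * fps_X ^ (n - k)) * qbinomial n k * x ^ Suc k * y ^ (n - k)"
      by (simp add: qbin_term_def algebra_simps)
    also have "qbinomial n (Suc k) * fps_X ^ triangle k * x ^ Suc k * y ^ (n - k) = y * qbin_term x y n (Suc k)"
    proof (cases "k = n")
      case False
      then have "n - k = Suc (n - Suc k)" using that by simp
      then show ?thesis by (simp add: qbin_term_def mult_ac)
    qed (simp add: qbin_term_def qbinomial_eq_0)
    finally show ?thesis
      unfolding e by (simp add: qbin_term_def mult_ac)
  qed
  have "(\<Sum>k\<le>Suc n. w k * qbin_term x y (Suc n) k) =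
     w 0 * qbin_term x y (Suc n) 0 + (\<Sum>k\<le>n. w (Suc k) * qbin_term x y (Suc n) (Suc k))"
    by (rule sum.atMost_Suc_shift)
  also have "(\<Sum>k\<le>n. w (Suc k) * qbin_term x y (Suc n) (Suc k)) =
     y * (\<Sum>k\<le>n. w (Suc k) * qbin_term x y n (Suc k)) + x * fps_X ^ n * (\<Sum>k\<le>n. w (Suc k) * qbin_term x y n k)"
    by (simp add: t algebra_simps sum.distrib sum_distrib_left)
  also have "w 0 * qbin_term x y (Suc n) 0 = y * (w 0 * qbin_term x y n 0)"
    by (simp add: qbin_term_def algebra_simps)
  also have "y * (w 0 * qbin_term x y n 0) + (y * (\<Sum>k\<le>n. w (Suc k) * qbin_term x y n (Suc k)) + x * fps_X ^ n * (\<Sum>k\<le>n. w (Suc k) * qbin_term x y n k))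
    = y * (\<Sum>k\<le>Suc n. w k * qbin_term x y n k) + x * fps_X ^ n * (\<Sum>k\<le>n. w (Suc k) * qbin_term x y n k)"
    by (simp add: sum.atMost_Suc_shift algebra_simps del: sum.atMost_Suc)
  also have "(\<Sum>k\<le>Suc n. w k * qbin_term x y n k) = (\<Sum>k\<le>n. w k * qbin_term x y n k)"
    by (simp add: qbin_term_def qbinomial_eq_0)
  finally show ?thesis .
qed

theorem q_binomial_theorem:
  "(\<Sum>k\<le>n. qbin_term x y n k) = (\<Prod>k<n. y + fps_X ^ k * x)"
proof (induction n)
  case 0 then show ?case by (simp add: qbin_term_def)
next
  case (Suc n)
  then show ?case using sum_qbin_term_Suc[of "\<lambda>_. 1" x y n] by (simp add: algebra_simps)
qed

text \<open>If one factor of a product vanishes, the derivative of the product is the derivative of that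
factor times the product of the others.\<close>

lemma q_binomial_derivative:
  assumes "y + fps_X ^ m * x = 0"
  shows "(\<Sum>k\<le>Suc m + n. of_nat k * qbin_term x y (Suc m + n) k) =
     x * fps_X ^ m * (\<Prod>k<m. y + fps_X ^ k * x) * (\<Prod>k\<in>{m<..m + n}. y + fps_X ^ k * x)"
proof (induction n)
  case 0
  have "(\<Sum>k\<le>Suc m. of_nat k * qbin_term x y (Suc m) k) =
      (y + fps_X ^ m * x) * (\<Sum>k\<le>m. of_nat k * qbin_term x y m k) + x * fps_X ^ m * (\<Sum>k\<le>m. qbin_term x y m k)"
    unfolding sum_qbin_term_Suc by (simp add: algebra_simps sum.distrib)
  then show ?case
    using assms q_binomial_theorem[of x y m] by simp
next
  case (Suc n)
  have z: "(\<Sum>k\<le>Suc m + n. qbin_term x y (Suc m + n) k) = 0"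
    unfolding q_binomial_theorem by (rule prod_zero) (use assms in auto)
  have "(\<Sum>k\<le>Suc (Suc m + n). of_nat k * qbin_term x y (Suc (Suc m + n)) k) =
      (y + fps_X ^ (Suc m + n) * x) * (\<Sum>k\<le>Suc m + n. of_nat k * qbin_term x y (Suc m + n) k)
       + x * fps_X ^ (Suc m + n) * (\<Sum>k\<le>Suc m + n. qbin_term x y (Suc m + n) k)"
    unfolding sum_qbin_term_Suc by (simp add: algebra_simps sum.distrib del: sum.atMost_Suc)
  also have "\<dots> = (y + fps_X ^ (Suc m + n) * x) * (x * fps_X ^ m * (\<Prod>k<m. y + fps_X ^ k * x) * (\<Prod>k\<in>{m<..m + n}. y + fps_X ^ k * x))"
    unfolding z Suc.IH by simp
  also have "\<dots> = x * fps_X ^ m * (\<Prod>k<m. y + fps_X ^ k * x) * (\<Prod>k\<in>{m<..m + Suc n}. y + fps_X ^ k * x)"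
  proof -
    have "{m<..m + Suc n} = insert (Suc m + n) {m<..m + n}" by auto
    then show ?thesis by (simp add: mult_ac)
  qed
  finally show ?case by simp
qed

lemma prod_X_power_diff_below:
  "(\<Prod>k<n. fps_X ^ n + fps_X ^ k * (- 1)) =
     ((-1) ^ n * fps_X ^ triangle (n - 1) * euler_poly n :: 'a::comm_ring_1 fps)"
proof -
  have "(\<Prod>k<n. fps_X ^ n + fps_X ^ k * (- 1)) = (\<Prod>k<n. (-1) * fps_X ^ k * (1 - fps_X ^ (n - k)) :: 'a fps)"
    by (intro prod.cong refl) (simp add: algebra_simps flip: power_add)
  also have "\<dots> = (-1) ^ n * (\<Prod>k<n. fps_X ^ k) * (\<Prod>k<n. 1 - fps_X ^ (n - k))"
    by (simp only: prod.distrib) simp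
  also have "(\<Prod>k<n. fps_X ^ k :: 'a fps) = fps_X ^ triangle (n - 1)"
  proof (induction n)
    case (Suc n)
    then show ?case by (cases n) (simp_all add: power_add mult_ac)
  qed simp
  also have "(\<Prod>k<n. 1 - fps_X ^ (n - k) :: 'a fps) = euler_poly n"
    unfolding euler_poly_def
    by (rule prod.reindex_bij_witness[of _ "\<lambda>i. n - i" "\<lambda>k. n - k"]) auto
  finally show ?thesis .
qed

lemma prod_X_power_diff_above:
  "(\<Prod>k\<in>{n<..n + n}. fps_X ^ n + fps_X ^ k * (- 1)) =
     (fps_X ^ (n * n) * euler_poly n :: 'a::comm_ring_1 fps)"
proof -
  have "(\<Prod>k\<in>{n<..n + n}. fps_X ^ n + fps_X ^ k * (- 1)) = (\<Prod>i\<in>{1..n}. fps_X ^ n * (1 - fps_X ^ i) :: 'a fps)"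
    by (rule prod.reindex_bij_witness[of _ "\<lambda>i. n + i" "\<lambda>k. k - n"])
      (auto simp: algebra_simps simp flip: power_add)
  also have "\<dots> = fps_X ^ (n * n) * euler_poly n"
    unfolding prod.distrib euler_poly_def by (simp add: power_mult)
  finally show ?thesis .
qed

lemma sum_split_middle:
  fixes f :: "nat \<Rightarrow> 'a::comm_monoid_add"
  shows "(\<Sum>k\<le>Suc n + n. f k) = (\<Sum>j\<le>n. f (Suc n + j)) + (\<Sum>j\<le>n. f (n - j))"
proof -
  have "{..Suc n + n} = (\<lambda>j. Suc n + j) ` {..n} \<union> {..n}"
  proof (intro set_eqI iffI)
    fix k assume "k \<in> {..Suc n + n}"
    then show "k \<in> (\<lambda>j. Suc n + j) ` {..n} \<union> {..n}"
      by (cases "k \<le> n") (auto intro!: image_eqI[of _ _ "k - Suc n"])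
  qed auto
  moreover have "sum f ((\<lambda>j. Suc n + j) ` {..n} \<union> {..n}) = sum f ((\<lambda>j. Suc n + j) ` {..n}) + sum f {..n}"
    by (intro sum.union_disjoint) auto
  moreover have "sum f ((\<lambda>j. Suc n + j) ` {..n}) = (\<Sum>j\<le>n. f (Suc n + j))"
    by (subst sum.reindex) (auto simp: inj_on_def)
  moreover have "sum f {..n} = (\<Sum>j\<le>n. f (n - j))"
    by (rule sum.reindex_bij_witness[of _ "\<lambda>j. n - j" "\<lambda>k. n - k"]) auto
  ultimately show ?thesis by simp
qed

lemma jacobi_exponents:
  assumes "j \<le> n"
  shows "triangle (n + j) + n * (n - j) = n * n + triangle n + triangle j"
    and "triangle (n - j - 1) + n * (Suc n + j) = n * n + triangle n + triangle j"
proof -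
  obtain d where n: "n = j + d" using assms le_Suc_ex by blast
  have "2 * (triangle (n + j) + n * (n - j)) = 2 * (n * n + triangle n + triangle j)"
    unfolding distrib_left triangle_double by (simp add: n algebra_simps)
  then show "triangle (n + j) + n * (n - j) = n * n + triangle n + triangle j" by simp
  have "2 * triangle (n - j - 1) = d * (d - 1)"
    by (cases d) (simp_all add: triangle_double n del: triangle_Suc)
  moreover have "d * (d - 1) + d = d * d" by (cases d) auto
  ultimately have "2 * (triangle (n - j - 1) + n * (Suc n + j)) + d = 2 * (n * n + triangle n + triangle j) + d"
    unfolding distrib_left triangle_double by (simp add: n algebra_simps)
  then show "triangle (n - j - 1) + n * (Suc n + j) = n * n + triangle n + triangle j" by simp
qed

text \<open>The finite form of Jacobi's identity: the derivative of the \<open>q\<close>-binomial theorem with \<open>2n + 1\<close> factors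
at \<open>y = q^n\<close>, \<open>x = -1\<close>, where precisely the middle factor vanishes. Up to sign and a
power of \<open>q\<close>, the other factors form two copies of \<open>(q;q)_n\<close>. On the other side the summands \<open>n + 1 + j\<close> and \<open>n - j\<close> carry the same power of \<open>q\<close>.\<close>

lemma jacobi_finite:
  "euler_poly n ^ 2 = (\<Sum>j\<le>n. (-1) ^ j * fps_X ^ triangle j *
     (of_nat (Suc n + j) * qbinomial (Suc n + n) (Suc n + j) - of_nat (n - j) * qbinomial (Suc n + n) (n - j))
      :: 'a::comm_ring_1 fps)"
proof -
  \<comment> \<open>The power of \<open>q\<close> common to both sides.\<close>
  define B where "B = n * n + triangle n"
  define w where "w j = (of_nat (Suc n + j) * qbinomial (Suc n + n) (Suc n + j) - of_nat (n - j) * qbinomial (Suc n + n) (n - j) :: 'a fps)" for j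
  let ?t = "qbin_term (- 1) (fps_X ^ n) (Suc n + n) :: nat \<Rightarrow> 'a fps"
  have up: "?t (Suc n + j) = (-1) ^ Suc n * fps_X ^ B * ((-1) ^ j * fps_X ^ triangle j * qbinomial (Suc n + n) (Suc n + j))"
    if "j \<le> n" for j
  proof -
    have "Suc n + n - (Suc n + j) = n - j" by simp
    moreover have "fps_X ^ triangle (n + j) * (fps_X ^ n) ^ (n - j) = (fps_X ^ B * fps_X ^ triangle j :: 'a fps)"
      unfolding B_def using jacobi_exponents(1)[OF that] by (simp only: flip: power_mult power_add)
    moreover have "?t (Suc n + j) = (fps_X ^ triangle (n + j) * (fps_X ^ n) ^ (Suc n + n - (Suc n + j))) *
        ((-1) ^ (Suc n + j) * qbinomial (Suc n + n) (Suc n + j))"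
      by (simp add: qbin_term_def mult_ac del: qbinomial.simps)
    ultimately show ?thesis
      by (simp add: power_add mult_ac del: qbinomial.simps)
  qed
  have down: "?t (n - j) = - ((-1) ^ Suc n * fps_X ^ B * ((-1) ^ j * fps_X ^ triangle j * qbinomial (Suc n + n) (n - j)))"
    if "j \<le> n" for j
  proof -
    have "(-1) ^ (n - j) = ((-1) ^ n * (-1) ^ j :: 'a fps)"
      using that by (simp add: uminus_power_if)
    moreover have "Suc n + n - (n - j) = Suc n + j" using that by simp
    moreover have "fps_X ^ triangle (n - j - 1) * (fps_X ^ n) ^ (Suc n + j) = (fps_X ^ B * fps_X ^ triangle j :: 'a fps)"
      unfolding B_def using jacobi_exponents(2)[OF that] by (simp only: flip: power_mult power_add)
    moreover have "?t (n - j) = (fps_X ^ triangle (n - j - 1) * (fps_X ^ n) ^ (Suc n + n - (n - j))) *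
        ((-1) ^ (n - j) * qbinomial (Suc n + n) (n - j))"
      by (simp add: qbin_term_def mult_ac del: qbinomial.simps)
    ultimately show ?thesis
      by (simp add: mult_ac del: qbinomial.simps)
  qed
  have "(\<Sum>k\<le>Suc n + n. of_nat k * ?t k) = (\<Sum>j\<le>n. of_nat (Suc n + j) * ?t (Suc n + j) + of_nat (n - j) * ?t (n - j))"
    unfolding sum_split_middle by (simp add: sum.distrib)
  also have "\<dots> = (\<Sum>j\<le>n. (-1) ^ Suc n * fps_X ^ B * ((-1) ^ j * fps_X ^ triangle j * w j))"
    by (intro sum.cong refl) (simp only: up down w_def atMost_iff, simp add: algebra_simps)
  also have "\<dots> = (-1) ^ Suc n * fps_X ^ B * (\<Sum>j\<le>n. (-1) ^ j * fps_X ^ triangle j * w j)"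
    by (simp only: sum_distrib_left)
  finally have "(-1) ^ Suc n * fps_X ^ B * (\<Sum>j\<le>n. (-1) ^ j * fps_X ^ triangle j * w j) =
     - 1 * fps_X ^ n * (\<Prod>k<n. fps_X ^ n + fps_X ^ k * (- 1)) * (\<Prod>k\<in>{n<..n + n}. fps_X ^ n + fps_X ^ k * (- 1))"
    using q_binomial_derivative[of "fps_X ^ n" n "- 1 :: 'a fps" n] by simp
  also have "\<dots> = (-1) ^ Suc n * (fps_X ^ n * fps_X ^ triangle (n - 1) * fps_X ^ (n * n)) * euler_poly n ^ 2"
    unfolding prod_X_power_diff_below prod_X_power_diff_above by (simp add: power2_eq_square mult_ac)
  also have "fps_X ^ n * fps_X ^ triangle (n - 1) * fps_X ^ (n * n) = (fps_X ^ B :: 'a fps)"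
    unfolding B_def by (cases n) (simp_all add: power_add mult_ac)
  finally have "fps_X ^ B * (\<Sum>j\<le>n. (-1) ^ j * fps_X ^ triangle j * w j) = fps_X ^ B * euler_poly n ^ 2"
    by (cases "even n") simp_all
  from fps_X_power_mult_cancel[OF this] show ?thesis
    unfolding w_def by (rule sym)
qed

text \<open>As \<open>n\<close>, \<open>k\<close> and \<open>n - k\<close> grow, the quotient \<open>(q;q)_n / ((q;q)_k (q;q)_(n-k))\<close> tends to the inverse
of Euler's product.\<close>

lemma trunc_eq_euler_mult_qbinomial:
  assumes "m \<le> k" "m \<le> n - k" "k \<le> n"
  shows "trunc_eq (Suc m) (euler * qbinomial n k) (1 :: 'a::comm_ring_1 fps)"
proof -
  have inv: "colour_partitions_fps 1 * euler = (1 :: 'a fps)"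
    using colour_partitions_fps_mult_euler[of 1] by simp
  have "trunc_eq (Suc m) (euler * euler * qbinomial n k) (euler_poly k * euler_poly (n - k) * qbinomial n k :: 'a fps)"
    using assms by (intro trunc_eq_mult trunc_eq_refl trunc_eq_sym[OF trunc_eq_euler']) auto
  also have "trunc_eq (Suc m) (euler_poly k * euler_poly (n - k) * qbinomial n k) (euler :: 'a fps)"
    unfolding qbinomial_mult_euler_poly[OF assms(3)] using assms by (intro trunc_eq_euler') auto
  finally have "trunc_eq (Suc m) (colour_partitions_fps 1 * (euler * euler * qbinomial n k)) (colour_partitions_fps 1 * euler :: 'a fps)"
    by (intro trunc_eq_mult) auto
  moreover have "colour_partitions_fps 1 * (euler * euler * qbinomial n k) =
      (colour_partitions_fps 1 * euler) * (euler * qbinomial n k :: 'a fps)"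
    by (simp only: mult_ac)
  ultimately show ?thesis by (simp only: inv mult_1_left)
qed

text \<open>Multiplying the finite identity by Euler's product turns the two \<open>q\<close>-binomial coefficients into \<open>1\<close>,
up to a degree \<open>n - j\<close> that the factor \<open>q^(j(j+1)/2)\<close> lifts above \<open>n\<close>. There remains
\<open>(n + 1 + j) - (n - j) = 2j + 1\<close>.\<close>

theorem jacobi_cube_trunc:
  "trunc_eq (Suc n) (euler ^ 3) (\<Sum>j\<le>n. (-1) ^ j * of_nat (2 * j + 1) * fps_X ^ triangle j :: 'a::comm_ring_1 fps)"
proof -
  have "trunc_eq (Suc n) (euler * euler ^ 2) (euler * euler_poly n ^ 2 :: 'a fps)"
    by (intro trunc_eq_mult trunc_eq_power trunc_eq_refl trunc_eq_euler)
  also have "euler * euler_poly n ^ 2 = (\<Sum>j\<le>n. fps_X ^ triangle j * ((-1) ^ j *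
     (of_nat (Suc n + j) * (euler * qbinomial (Suc n + n) (Suc n + j)) - of_nat (n - j) * (euler * qbinomial (Suc n + n) (n - j)))) :: 'a fps)"
    unfolding jacobi_finite sum_distrib_left by (intro sum.cong refl) (simp add: algebra_simps)
  also have "trunc_eq (Suc n) \<dots> (\<Sum>j\<le>n. fps_X ^ triangle j * ((-1) ^ j *
     (of_nat (Suc n + j) * 1 - of_nat (n - j) * 1)) :: 'a fps)"
  proof (intro trunc_eq_sum)
    fix j assume "j \<in> {..n}"
    then have j: "j \<le> n" by simp
    show "trunc_eq (Suc n) (fps_X ^ triangle j * ((-1) ^ j *
       (of_nat (Suc n + j) * (euler * qbinomial (Suc n + n) (Suc n + j)) - of_nat (n - j) * (euler * qbinomial (Suc n + n) (n - j)))))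
       (fps_X ^ triangle j * ((-1) ^ j * (of_nat (Suc n + j) * 1 - of_nat (n - j) * 1)) :: 'a fps)"
    proof (rule trunc_eq_X_power_mult)
      show "trunc_eq (Suc (n - j)) ((-1) ^ j *
       (of_nat (Suc n + j) * (euler * qbinomial (Suc n + n) (Suc n + j)) - of_nat (n - j) * (euler * qbinomial (Suc n + n) (n - j))))
       ((-1) ^ j * (of_nat (Suc n + j) * 1 - of_nat (n - j) * 1) :: 'a fps)"
        using j by (intro trunc_eq_mult trunc_eq_diff trunc_eq_refl trunc_eq_euler_mult_qbinomial) auto
      show "Suc n \<le> triangle j + Suc (n - j)"
        using le_triangle[of j] by simp
    qed
  qed
  also have "(\<Sum>j\<le>n. fps_X ^ triangle j * ((-1) ^ j * (of_nat (Suc n + j) * 1 - of_nat (n - j) * 1))) =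
     (\<Sum>j\<le>n. (-1) ^ j * of_nat (2 * j + 1) * fps_X ^ triangle j :: 'a fps)"
    by (intro sum.cong refl) (simp add: of_nat_diff algebra_simps)
  finally show ?thesis
    by (simp add: power2_eq_square power3_eq_cube mult.assoc)
qed

section \<open>Exponents modulo 7\<close>

lemma fps_const_mult_X_power_nth:
  "(fps_const c * fps_X ^ k) $ n = (if n = k then c else (0::'a::comm_ring_1))"
  by (simp add: fps_X_power_nth)

definition residues_in :: "nat set \<Rightarrow> 'a::zero fps \<Rightarrow> bool" where
  "residues_in R f \<longleftrightarrow> (\<forall>n. f $ n \<noteq> 0 \<longrightarrow> n mod 7 \<in> R)"

lemma residues_in_nth_eq_0: "residues_in R f \<Longrightarrow> n mod 7 \<notin> R \<Longrightarrow> f $ n = 0"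
  by (auto simp: residues_in_def)

lemma residues_in_mult:
  fixes f g :: "'a::comm_ring_1 fps"
  assumes "residues_in R f" "residues_in S g" "\<And>x y. x \<in> R \<Longrightarrow> y \<in> S \<Longrightarrow> (x + y) mod 7 \<in> T"
  shows "residues_in T (f * g)"
  unfolding residues_in_def
proof (intro allI impI)
  fix n assume "(f * g) $ n \<noteq> 0"
  then obtain i where i: "i \<le> n" "f $ i * g $ (n - i) \<noteq> 0"
    unfolding fps_mult_nth by (metis (no_types, lifting) atLeastAtMost_iff sum.neutral)
  then have "f $ i \<noteq> 0" "g $ (n - i) \<noteq> 0" by auto
  then have "(i mod 7 + (n - i) mod 7) mod 7 \<in> T"
    using assms by (auto simp: residues_in_def)
  moreover have "(i mod 7 + (n - i) mod 7) mod 7 = (i + (n - i)) mod 7"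
    by (rule mod_add_eq)
  ultimately show "n mod 7 \<in> T" using i(1) by simp
qed

definition section7 :: "nat \<Rightarrow> 'a::zero fps \<Rightarrow> 'a fps" where
  "section7 r f = Abs_fps (\<lambda>n. if n mod 7 = r then f $ n else 0)"

lemma section7_nth [simp]: "section7 r f $ n = (if n mod 7 = r then f $ n else 0)"
  by (simp add: section7_def)

lemma section7_eq_0: "residues_in R f \<Longrightarrow> r \<notin> R \<Longrightarrow> section7 r f = 0"
  by (rule fps_ext) (auto simp: residues_in_def)

lemma lessThan_7: "{..<7::nat} = {0, 1, 2, 3, 4, 5, 6}"
  by auto

lemma sum_section7: "(\<Sum>i<7. section7 i f) = (f :: 'a::comm_ring_1 fps)"
  by (rule fps_ext) (simp add: fps_sum_nth sum.delta)

lemma section7_mult: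
  fixes f g :: "'a::comm_ring_1 fps"
  assumes "r < 7"
  shows "section7 r (f * g) = (\<Sum>i<7. section7 i f * section7 ((r + 7 - i) mod 7) g)"
proof (rule fps_ext)
  fix n :: nat
  have eq: "(\<Sum>i<7. section7 i f $ k * section7 ((r + 7 - i) mod 7) g $ (n - k)) =
      (if n mod 7 = r then f $ k * g $ (n - k) else 0)" if "k \<le> n" for k
  proof -
    have "(n - k) mod 7 = (r + 7 - k mod 7) mod 7 \<longleftrightarrow> n mod 7 = r"
    proof -
      have "(n - k) mod 7 = (r + 7 - k mod 7) mod 7 \<longleftrightarrow> [(n - k) + k = (r + 7 - k mod 7) + k] (mod 7)"
        unfolding cong_add_rcancel_nat by (simp only: cong_def)
      also have "(n - k) + k = n" using that by simp
      also have "(r + 7 - k mod 7) + k = r + 7 * Suc (k div 7)"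
      proof -
        have "r + 7 - t + (q * 7 + t) = r + 7 * Suc q" if "t < 7" for q t
          using that by simp
        from this[of "k mod 7" "k div 7"] show ?thesis by simp
      qed
      also have "[n = r + 7 * Suc (k div 7)] (mod 7) \<longleftrightarrow> n mod 7 = r"
        unfolding cong_def mod_mult_self2 using assms by simp
      finally show ?thesis .
    qed
    then have "section7 ((r + 7 - k mod 7) mod 7) g $ (n - k) = (if n mod 7 = r then g $ (n - k) else 0)"
      by simp
    moreover have "(\<Sum>i<7. section7 i f $ k * section7 ((r + 7 - i) mod 7) g $ (n - k)) =
      (\<Sum>i<7. if i = k mod 7 then f $ k * section7 ((r + 7 - k mod 7) mod 7) g $ (n - k) else 0)"
      by (intro sum.cong refl) (simp del: section7_nth add: section7_nth[of _ f])
    ultimately show ?thesis by (simp add: sum.delta)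
  qed
  have "(\<Sum>i<7. section7 i f * section7 ((r + 7 - i) mod 7) g) $ n =
     (\<Sum>k=0..n. \<Sum>i<7. section7 i f $ k * section7 ((r + 7 - i) mod 7) g $ (n - k))"
    unfolding fps_sum_nth fps_mult_nth by (rule sum.swap)
  also have "\<dots> = section7 r (f * g) $ n"
    by (simp add: eq fps_mult_nth del: section7_nth) (simp add: fps_mult_nth)
  finally show "section7 r (f * g) $ n = (\<Sum>i<7. section7 i f * section7 ((r + 7 - i) mod 7) g) $ n" ..
qed

section \<open>Seventh powers in characteristic 7\<close>

lemma CHAR_7: "CHAR(7) = 7" "CHAR(7 fps) = 7"
  by simp_all

lemma seven_eq_0: "(7 :: 7 fps) = 0"
  using of_nat_CHAR[where ?'a = "7 fps"] by simp

lemma fermat_7: "(x :: 7) ^ 7 = x"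
proof -
  have "of_nat n ^ 7 = (of_nat n :: 7)" for n
    by (induction n) (simp_all add: freshmans_dream)
  moreover obtain n where "x = of_nat n"
    by (cases x rule: bit1_cases) (metis of_int_of_nat_eq zero_le_imp_eq_int)
  ultimately show ?thesis by simp
qed

text \<open>That is, \<open>f(q)^7 = f(q^7)\<close>: taking seventh powers is additive, and it fixes the coefficients.\<close>

lemma power7_nth:
  "(f ^ 7) $ n = (if 7 dvd n then f $ (n div 7) else 0)" for f :: "7 fps"
proof -
  have "trunc_eq (Suc n) f (\<Sum>i\<le>n. fps_const (f $ i) * fps_X ^ i)"
    by (simp only: trunc_eq_def fps_sum_nth fps_const_mult_X_power_nth) simp
  then have "trunc_eq (Suc n) (f ^ 7) ((\<Sum>i\<le>n. fps_const (f $ i) * fps_X ^ i) ^ 7)"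
    by (rule trunc_eq_power)
  also have "(\<Sum>i\<le>n. fps_const (f $ i) * fps_X ^ i) ^ 7 = (\<Sum>i\<le>n. fps_const (f $ i) * fps_X ^ (7 * i))"
    by (subst freshmans_dream_sum) (simp_all add: power_mult_distrib fps_const_power fermat_7 mult.commute flip: power_mult)
  finally have "(f ^ 7) $ n = (\<Sum>i\<le>n. if n = 7 * i then f $ i else 0)"
    unfolding trunc_eq_def fps_sum_nth fps_const_mult_X_power_nth by blast
  also have "\<dots> = (\<Sum>i\<le>n. if i = n div 7 then (if 7 dvd n then f $ i else 0) else 0)"
    by (intro sum.cong refl) auto
  finally show ?thesis by (simp add: sum.delta)
qed

lemma residues_in_power7: "residues_in {0} (f ^ 7 :: 7 fps)"
  by (auto simp: residues_in_def power7_nth)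

text \<open>The Atkin operator \<open>U_7\<close> applied to \<open>q^(-r) f\<close>. It is linear over series
in \<open>q^7\<close>, that is, over seventh powers.\<close>

definition extract7 :: "nat \<Rightarrow> 'a::zero fps \<Rightarrow> 'a fps" where
  "extract7 r f = Abs_fps (\<lambda>n. f $ (7 * n + r))"

lemma extract7_nth [simp]: "extract7 r f $ n = f $ (7 * n + r)"
  by (simp add: extract7_def)

lemma extract7_mult_power7:
  fixes f g :: "7 fps"
  assumes "r < 7"
  shows "extract7 r (f * g ^ 7) = extract7 r f * g"
proof (rule fps_ext)
  fix n
  have "extract7 r (f * g ^ 7) $ n = (\<Sum>k\<le>7 * n + r. (g ^ 7) $ k * f $ (7 * n + r - k))"
    by (simp add: mult.commute[of f] fps_mult_nth atLeast0AtMost)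
  also have "\<dots> = (\<Sum>k\<in>(*) 7 ` {..n}. (g ^ 7) $ k * f $ (7 * n + r - k))"
  proof (rule sum.mono_neutral_right)
    show "\<forall>k\<in>{..7 * n + r} - (*) 7 ` {..n}. (g ^ 7) $ k * f $ (7 * n + r - k) = 0"
      using assms by (auto simp: power7_nth elim!: dvdE)
  qed auto
  also have "\<dots> = (\<Sum>k\<le>n. g $ k * f $ (7 * (n - k) + r))"
    by (subst sum.reindex) (auto simp: inj_on_def power7_nth diff_mult_distrib2 intro!: sum.cong)
  also have "\<dots> = (extract7 r f * g) $ n"
    by (simp add: mult.commute[of _ g] fps_mult_nth atLeast0AtMost)
  finally show "extract7 r (f * g ^ 7) $ n = (extract7 r f * g) $ n" .
qed

lemma extract7_eq_of_section7:
  fixes g :: "7 fps"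
  assumes "section7 r f = fps_const c * fps_X ^ r * g ^ 7" "r < 7"
  shows "extract7 r f = fps_const c * g"
proof -
  have "extract7 r f = extract7 r (section7 r f)"
    using assms(2) by (intro fps_ext) simp
  also have "\<dots> = extract7 r (fps_const c * fps_X ^ r) * g"
    unfolding assms(1) by (rule extract7_mult_power7) fact
  also have "extract7 r (fps_const c * fps_X ^ r) = fps_const c"
    by (rule fps_ext) (simp add: fps_X_power_nth)
  finally show ?thesis .
qed

section \<open>Exponents of Euler's product and of its cube modulo 7\<close>

lemma mod_7_cases: "k mod 7 \<in> {0, 1, 2, 3, 4, 5, 6 :: nat}"
  using lessThan_7 by (metis lessThan_iff mod_less_divisor zero_less_numeral)

lemma triangle_mod_7: "triangle j mod 7 = (4 * (j mod 7) * Suc (j mod 7)) mod 7"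
proof -
  have "4 * (2 * triangle j) = triangle j + triangle j * 7" by simp
  then have "triangle j mod 7 = (4 * (2 * triangle j)) mod 7"
    by (simp only: mod_mult_self1)
  also have "\<dots> = (4 * (j mod 7) * Suc (j mod 7)) mod 7"
    unfolding triangle_double mult.assoc by (intro mod_mult_cong; simp add: mod_simps)+
  finally show ?thesis .
qed

lemma residues_in_euler: "residues_in {0, 1, 2, 5} (euler :: 'a::comm_ring_1 fps)"
proof -
  have k: "(k * k + triangle k) mod 7 \<in> {0, 1, 2, 5} \<and> (Suc k * Suc k + triangle k) mod 7 \<in> {0, 1, 2, 5}" for k
  proof -
    have "(k * k + triangle k) mod 7 = ((k mod 7) * (k mod 7) + triangle k mod 7) mod 7"
      "(Suc k * Suc k + triangle k) mod 7 = (Suc (k mod 7) * Suc (k mod 7) + triangle k mod 7) mod 7"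
      by (intro mod_add_cong mod_mult_cong; simp add: mod_simps)+
    then show ?thesis
      using mod_7_cases[of k] unfolding triangle_mod_7[of k] by (elim insertE emptyE) simp_all
  qed
  have "euler $ n = (0::'a)" if "n mod 7 \<notin> {0, 1, 2, 5}" for n
  proof -
    have "euler $ n = ((\<Sum>k\<le>n. (-1) ^ k * fps_X ^ (k * k + triangle k)) -
     (\<Sum>k<n. (-1) ^ k * fps_X ^ (Suc k * Suc k + triangle k)) :: 'a fps) $ n"
      using pentagonal_number_trunc[of n] unfolding trunc_eq_def by blast
    also have "\<dots> = 0"
    proof -
      have z: "((-1) ^ k * fps_X ^ m :: 'a fps) $ n = 0" if "n \<noteq> m" for k m
        using that by (simp add: uminus_power_if fps_X_power_nth)
      have "n \<noteq> k * k + triangle k" "n \<noteq> Suc k * Suc k + triangle k" for k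
        using k[of k] that by metis+
      then show ?thesis
        unfolding fps_sub_nth fps_sum_nth by (simp only: z not_False_eq_True sum.neutral_const) simp
    qed
    finally show ?thesis .
  qed
  then show ?thesis unfolding residues_in_def by blast
qed

text \<open>A triangular number is \<open>0\<close>, \<open>1\<close>, \<open>3\<close> or \<open>6\<close> modulo \<open>7\<close>. The residue \<open>6\<close> comes only from
\<open>j \<equiv> 3\<close>, where the coefficient \<open>2j + 1\<close> in Jacobi's identity is divisible by \<open>7\<close>.\<close>

lemma residues_in_euler_cube: "residues_in {0, 1, 3} (euler ^ 3 :: 7 fps)"
proof -
  have "(euler ^ 3) $ n = (0::7)" if n: "n mod 7 \<notin> {0, 1, 3}" for n
  proof -
    have "(euler ^ 3) $ n = (\<Sum>j\<le>n. (-1) ^ j * of_nat (2 * j + 1) * fps_X ^ triangle j :: 7 fps) $ n"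
      using jacobi_cube_trunc[of n] unfolding trunc_eq_def by blast
    also have "\<dots> = (\<Sum>j\<le>n. ((-1) ^ j * of_nat (2 * j + 1) * fps_X ^ triangle j :: 7 fps) $ n)"
      by (rule fps_sum_nth)
    also have "\<dots> = 0"
    proof (rule sum.neutral, rule ballI)
      fix j
      show "((-1) ^ j * of_nat (2 * j + 1) * fps_X ^ triangle j :: 7 fps) $ n = 0"
      proof (cases "j mod 7 = 3")
        case True
        then have "7 dvd 2 * j + 1" by presburger
        then have "of_nat (2 * j + 1) = (0 :: 7 fps)"
          by (metis CHAR_7(2) of_nat_eq_0_iff_char_dvd)
        then show ?thesis by (simp only: mult_zero_left mult_zero_right fps_zero_nth)
      next
        case False
        then have "n \<noteq> triangle j"
          using n triangle_mod_7[of j] mod_7_cases[of j] by (elim insertE emptyE) auto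
        moreover have "(-1) ^ j * of_nat (2 * j + 1) = (fps_const ((-1) ^ j * of_nat (2 * j + 1)) :: 7 fps)"
          by (simp add: uminus_power_if flip: fps_of_nat)
        ultimately show ?thesis by (simp only: fps_const_mult_X_power_nth if_False)
      qed
    qed
    finally show ?thesis .
  qed
  then show ?thesis unfolding residues_in_def by blast
qed

section \<open>Self-similarity of Euler's product\<close>

lemma pentagonal_number_nth:
  "euler $ n = ((\<Sum>k | k * k + triangle k = n. (-1) ^ k) -
     (\<Sum>k | Suc k * Suc k + triangle k = n. (-1) ^ k) :: 'a::comm_ring_1)"
proof -
  have coeff: "((-1) ^ k * fps_X ^ m :: 'a fps) $ n = (if m = n then (-1) ^ k else 0)" for k m
    by (simp add: uminus_power_if fps_X_power_nth)
  have "k \<le> k * k" for k :: nat by (cases k) auto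
  then have A: "{k. k * k + triangle k = n} = {k \<in> {..n}. k * k + triangle k = n}"
    using trans_le_add1 by blast
  have "k < Suc k * Suc k + triangle k" for k by simp
  then have B: "{k. Suc k * Suc k + triangle k = n} = {k \<in> {..<n}. Suc k * Suc k + triangle k = n}"
    by blast
  have "euler $ n = ((\<Sum>k\<le>n. (-1) ^ k * fps_X ^ (k * k + triangle k)) -
     (\<Sum>k<n. (-1) ^ k * fps_X ^ (Suc k * Suc k + triangle k)) :: 'a fps) $ n"
    using pentagonal_number_trunc[of n] unfolding trunc_eq_def by blast
  then show ?thesis
    unfolding A B fps_sub_nth fps_sum_nth coeff
    by (simp only: sum.inter_filter finite_atMost finite_lessThan)
qed

lemma pentagonal_mod_7:
  "(k * k + triangle k) mod 7 = ((k mod 7) * (k mod 7) + triangle k mod 7) mod 7"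
  "(Suc k * Suc k + triangle k) mod 7 = (Suc (k mod 7) * Suc (k mod 7) + triangle k mod 7) mod 7"
  by (intro mod_add_cong mod_mult_cong; simp add: mod_simps)+

text \<open>Since \<open>24 j(3j+1)/2 + 1 = (6j+1)^2\<close>, a pentagonal number is \<open>2\<close> modulo \<open>7\<close> iff \<open>7\<close> divides
\<open>6j + 1\<close>, that is, iff \<open>j \<equiv> 1\<close>.\<close>

lemma pentagonal_mod_7_eq_2:
  "(k * k + triangle k) mod 7 = 2 \<Longrightarrow> k mod 7 = 1"
  "(Suc k * Suc k + triangle k) mod 7 = 2 \<Longrightarrow> k mod 7 = 5"
  using mod_7_cases[of k] unfolding pentagonal_mod_7 triangle_mod_7[of k]
  by (elim insertE emptyE; simp)+

text \<open>With \<open>6j + 1 = 7(6i + 1)\<close>, i.e. \<open>j = 7i + 1\<close>, the \<open>j\<close>-th pentagonal number is \<open>49\<close> times the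
\<open>i\<close>-th one, plus \<open>2\<close>. In the second family \<open>j = -(k+1)\<close> and \<open>i = -(l+1)\<close>, whence \<open>k = 7l + 5\<close>.\<close>

lemma pentagonal_49_rescaling:
  "(7 * l + 1) * (7 * l + 1) + triangle (7 * l + 1) = 49 * (l * l + triangle l) + 2"
  "Suc (7 * l + 5) * Suc (7 * l + 5) + triangle (7 * l + 5) = 49 * (Suc l * Suc l + triangle l) + 2"
proof -
  have "2 * ((7 * l + 1) * (7 * l + 1) + triangle (7 * l + 1)) = 2 * (49 * (l * l + triangle l) + 2)"
    unfolding distrib_left mult.left_commute[of 2 49] triangle_double by (simp add: algebra_simps)
  then show "(7 * l + 1) * (7 * l + 1) + triangle (7 * l + 1) = 49 * (l * l + triangle l) + 2"
    by simp
  have "2 * (Suc (7 * l + 5) * Suc (7 * l + 5) + triangle (7 * l + 5)) = 2 * (49 * (Suc l * Suc l + triangle l) + 2)"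
    unfolding distrib_left mult.left_commute[of 2 49] triangle_double by (simp add: algebra_simps)
  then show "Suc (7 * l + 5) * Suc (7 * l + 5) + triangle (7 * l + 5) = 49 * (Suc l * Suc l + triangle l) + 2"
    by simp
qed

lemma euler_nth_49:
  "euler $ (49 * m + 2) = (- (euler $ m) :: 'a::comm_ring_1)"
proof -
  have m: "(49 * m + 2) mod 7 = 2" by presburger
  note r1 = pentagonal_mod_7_eq_2(1)[OF trans[OF arg_cong[of _ _ "\<lambda>x. x mod 7"] m]]
  note r2 = pentagonal_mod_7_eq_2(2)[OF trans[OF arg_cong[of _ _ "\<lambda>x. x mod 7"] m]]
  note e1 = pentagonal_49_rescaling(1)
  note e2 = pentagonal_49_rescaling(2)
  have s1: "(\<Sum>k | k * k + triangle k = 49 * m + 2. (-1) ^ k) =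
      (\<Sum>l | l * l + triangle l = m. (-1) ^ (7 * l + 1) :: 'a)"
  proof (rule sum.reindex_bij_witness[of _ "\<lambda>l. 7 * l + 1" "\<lambda>k. k div 7"])
    fix k assume "k \<in> {k. k * k + triangle k = 49 * m + 2}"
    then have k: "k * k + triangle k = 49 * m + 2" by simp
    show d: "7 * (k div 7) + 1 = k"
      using r1[OF k] mult_div_mod_eq[of 7 k] by simp
    have "49 * (k div 7 * (k div 7) + triangle (k div 7)) + 2 = 49 * m + 2"
      using e1[of "k div 7"] unfolding d k by simp
    then show "k div 7 \<in> {l. l * l + triangle l = m}" by simp
    show "(-1) ^ (7 * (k div 7) + 1) = ((-1) ^ k :: 'a)" unfolding d ..
  next
    fix l assume "l \<in> {l. l * l + triangle l = m}"
    then show "7 * l + 1 \<in> {k. k * k + triangle k = 49 * m + 2}"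
      unfolding mem_Collect_eq e1 by simp
  qed simp
  have s2: "(\<Sum>k | Suc k * Suc k + triangle k = 49 * m + 2. (-1) ^ k) =
      (\<Sum>l | Suc l * Suc l + triangle l = m. (-1) ^ (7 * l + 5) :: 'a)"
  proof (rule sum.reindex_bij_witness[of _ "\<lambda>l. 7 * l + 5" "\<lambda>k. k div 7"])
    fix k assume "k \<in> {k. Suc k * Suc k + triangle k = 49 * m + 2}"
    then have k: "Suc k * Suc k + triangle k = 49 * m + 2" by simp
    show d: "7 * (k div 7) + 5 = k"
      using r2[OF k] mult_div_mod_eq[of 7 k] by simp
    have "49 * (Suc (k div 7) * Suc (k div 7) + triangle (k div 7)) + 2 = 49 * m + 2"
      using e2[of "k div 7"] unfolding d k by (rule sym)
    then show "k div 7 \<in> {l. Suc l * Suc l + triangle l = m}" by simp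
    show "(-1) ^ (7 * (k div 7) + 5) = ((-1) ^ k :: 'a)" unfolding d ..
  next
    fix l assume "l \<in> {l. Suc l * Suc l + triangle l = m}"
    then show "7 * l + 5 \<in> {k. Suc k * Suc k + triangle k = 49 * m + 2}"
      unfolding mem_Collect_eq e2 by simp
  qed simp
  have "(-1) ^ (7 * l + 1) = (- ((-1) ^ l) :: 'a)" "(-1) ^ (7 * l + 5) = (- ((-1) ^ l) :: 'a)" for l
    by (simp_all add: uminus_power_if)
  then show ?thesis
    unfolding pentagonal_number_nth s1 s2 by (simp add: sum_negf)
qed

lemma mod_49: "(49 * t + 2) mod 49 = (2::nat)"
  by (simp only: mod_mult_self4) simp

lemma euler_nth_eq_0:
  assumes "n mod 7 = 2" "n mod 49 \<noteq> 2"
  shows "euler $ n = (0 :: 'a::comm_ring_1)"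
proof -
  have A: "k * k + triangle k \<noteq> n" for k
  proof
    assume n: "k * k + triangle k = n"
    then have "k mod 7 = 1" using assms(1) pentagonal_mod_7_eq_2(1) by blast
    then have "7 * (k div 7) + 1 = k" using mult_div_mod_eq[of 7 k] by simp
    then have "n = 49 * (k div 7 * (k div 7) + triangle (k div 7)) + 2"
      using n pentagonal_49_rescaling(1)[of "k div 7"] by simp
    then show False using assms(2) mod_49 by metis
  qed
  have B: "Suc k * Suc k + triangle k \<noteq> n" for k
  proof
    assume n: "Suc k * Suc k + triangle k = n"
    then have "k mod 7 = 5" using assms(1) pentagonal_mod_7_eq_2(2) by blast
    then have "7 * (k div 7) + 5 = k" using mult_div_mod_eq[of 7 k] by simp
    then have "n = 49 * (Suc (k div 7) * Suc (k div 7) + triangle (k div 7)) + 2"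
      using n pentagonal_49_rescaling(2)[of "k div 7"] by simp
    then show False using assms(2) mod_49 by metis
  qed
  have "{k. k * k + triangle k = n} = {}" "{k. Suc k * Suc k + triangle k = n} = {}"
    using A B by blast+
  then show ?thesis
    unfolding pentagonal_number_nth by (simp only: sum.empty diff_self)
qed

text \<open>By the rescaling of pentagonal numbers this section is \<open>-q^2 E(q^49)\<close>, with a minus sign because
\<open>7i + 1\<close> and \<open>i\<close> have opposite parity; and \<open>E(q^49) = E(q)^49\<close> in characteristic \<open>7\<close>.\<close>

lemma section7_2_euler: "section7 2 euler = (- (fps_X ^ 2 * euler ^ 49) :: 7 fps)"
proof (rule fps_ext)
  fix n :: nat
  have p: "(euler ^ 49 :: 7 fps) $ m = (if 49 dvd m then euler $ (m div 49) else 0)" for m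
  proof -
    have "(euler ^ 49 :: 7 fps) = (euler ^ 7) ^ 7" by (simp flip: power_mult)
    moreover have "7 dvd m \<and> 7 dvd m div 7 \<longleftrightarrow> 49 dvd m" by presburger
    moreover have "m div 7 div 7 = m div 49" by (simp flip: div_mult2_eq)
    ultimately show ?thesis by (simp only: power7_nth) auto
  qed
  show "section7 2 euler $ n = (- (fps_X ^ 2 * euler ^ 49) :: 7 fps) $ n"
  proof (cases "n mod 49 = 2")
    case True
    then have n: "n = 49 * (n div 49) + 2" using mult_div_mod_eq[of 49 n] by simp
    have "n mod 7 = 2" by (subst n) presburger
    then have "section7 2 euler $ n = (- (euler $ (n div 49)) :: 7)"
      using euler_nth_49[of "n div 49", where ?'a = 7] n by simp
    moreover have "\<not> n < 2" "n - 2 = 49 * (n div 49)" using n by linarith+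
    then have "(- (fps_X ^ 2 * euler ^ 49) :: 7 fps) $ n = - (euler $ (n div 49))"
      by (simp add: fps_X_power_mult_nth p)
    ultimately show ?thesis by simp
  next
    case False
    have "\<not> 49 dvd n - 2" if "\<not> n < 2"
    proof
      assume "49 dvd n - 2"
      then obtain t where "n - 2 = 49 * t" ..
      then have "n = 49 * t + 2" using that by simp
      then show False using False mod_49 by metis
    qed
    then have "(- (fps_X ^ 2 * euler ^ 49) :: 7 fps) $ n = 0"
      by (simp add: fps_X_power_mult_nth p)
    then show ?thesis using False euler_nth_eq_0[of n, where ?'a = 7] by simp
  qed
qed

text \<open>Over an arbitrary commutative ring a series can be cancelled as soon as its leading coefficient is
a unit; degree \<open>1\<close> is the case that occurs below.\<close>

lemma fps_mult_eq_0_imp: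
  fixes f g :: "'a::comm_ring_1 fps"
  assumes "f $ 0 = 0" "f $ 1 * t = 1" "f * g = 0"
  shows "g = 0"
proof -
  have "g $ n = 0" for n
  proof (induction n rule: less_induct)
    case (less n)
    have "0 = (f * g) $ Suc n"
      using assms(3) by simp
    also have "\<dots> = (\<Sum>i=0..Suc n. f $ i * g $ (Suc n - i))"
      by (rule fps_mult_nth)
    also have "\<dots> = (\<Sum>i=0..Suc n. if i = 1 then f $ 1 * g $ n else 0)"
    proof (intro sum.cong refl)
      fix i assume "i \<in> {0..Suc n}"
      then show "f $ i * g $ (Suc n - i) = (if i = 1 then f $ 1 * g $ n else 0)"
        using less.IH[of "Suc n - i"] assms(1) by (cases "i = 0"; cases "i = 1") auto
    qed
    also have "\<dots> = f $ 1 * g $ n" by (simp add: sum.delta)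
    finally have "t * (f $ 1 * g $ n) = 0" by simp
    then show ?case using assms(2) by (metis mult.assoc mult.commute mult_1_left)
  qed
  then show ?thesis by (simp add: fps_eq_iff)
qed

section \<open>The 7-dissection of Euler's product\<close>

text \<open>The next two identities hold modulo the four relations of the 7-dissection of Euler's product and
modulo \<open>7\<close>; the right-hand side of the first step of each proof exhibits the combination. Everything
is compatible with the cyclic substitution \<open>a \<rightarrow> b \<rightarrow> d \<rightarrow> a\<close>, which fixes \<open>c\<close> and permutes the first three
relations; solving linear equations over the field with seven elements for cofactors with this symmetry gives
the ones below.\<close>

lemma quintic_identity:
  fixes a b c d :: "'a::comm_ring_1"
  assumes "a^2 * c + a * b^2 + c^2 * d = 0" "a * c^2 + b^2 * c + b * d^2 = 0"
    "a^2 * d + b * c^2 + c * d^2 = 0" "a * b * d = c^3" "(7::'a) = 0"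
  shows "(2*b*c + d^2) * (a^3 + 3*b^2*d + 6*a*c*d) + (b^2 + 2*a*c) * (3*a^2*b + 6*b*c*d + d^3)
     + (a^2 + 2*c*d) * (b^3 + 6*a*b*c + 3*a*d^2) = 3 * c * (a^3*b + b^3*d + d^3*a + c^4)"
proof -
  have "(2*b*c + d^2) * (a^3 + 3*b^2*d + 6*a*c*d) + (b^2 + 2*a*c) * (3*a^2*b + 6*b*c*d + d^3)
     + (a^2 + 2*c*d) * (b^3 + 6*a*b*c + 3*a*d^2) = 3 * c * (a^3*b + b^3*d + d^3*a + c^4) 
     + 4 * (a*b*(a^2 * c + a * b^2 + c^2 * d) + b*d*(a * c^2 + b^2 * c + b * d^2) + a*d*(a^2 * d + b * c^2 + c * d^2))
     + 24 * c^2 * (a*b*d - c^3) + 7 * (a^3*b*c + b^3*c*d + a*c*d^3 + 3*c^5)"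
    by (simp add: algebra_simps power2_eq_square power3_eq_cube eval_nat_numeral)
  then show ?thesis unfolding assms by simp
qed

text \<open>Here the cofactors \<open>a^5\<close>, \<open>b^5\<close>, \<open>d^5\<close> trade the seventh powers for the squares \<open>a^6 b^2\<close>,
\<open>b^6 d^2\<close>, \<open>d^6 a^2\<close> of the left-hand side, and \<open>a b d = c^3\<close> turns the mixed terms of the square into
multiples of \<open>c^2\<close>; the remaining cofactors settle the quotient, of degree six.\<close>

lemma octic_identity:
  fixes a b c d :: "'a::comm_ring_1"
  assumes "a^2 * c + a * b^2 + c^2 * d = 0" "a * c^2 + b^2 * c + b * d^2 = 0"
    "a^2 * d + b * c^2 + c * d^2 = 0" "a * b * d = c^3" "(7::'a) = 0"
  shows "(a^3*b + b^3*d + d^3*a + c^4)^2 = - c * (a^7 + b^7 + c^7 + d^7)"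
proof -
  have "(a^3*b + b^3*d + d^3*a + c^4)^2 = - c * (a^7 + b^7 + c^7 + d^7) +
     (a^5 + c^2 * (3*a*b*c - b^3)) * (a^2 * c + a * b^2 + c^2 * d) +
     (b^5 + c^2 * (3*b*d*c - d^3)) * (a * c^2 + b^2 * c + b * d^2) +
     (d^5 + c^2 * (3*a*d*c - a^3)) * (a^2 * d + b * c^2 + c * d^2) +
     (2 * (a^2*b^3 + b^2*d^3 + d^2*a^3) - 9 * c^5) * (a*b*d - c^3) - 7 * c^8"
    by (simp add: algebra_simps power2_eq_square power3_eq_cube eval_nat_numeral)
  then show ?thesis unfolding assms by simp
qed

lemma section7_eq_0_outside:
  fixes f :: "'a::comm_ring_1 fps"
  assumes "residues_in {0, 1, 2, 5} f"
  shows "section7 3 f = 0" "section7 4 f = 0" "section7 6 f = 0"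
  by (rule section7_eq_0[OF assms]; simp)+

text \<open>Sort the terms of \<open>E^2\<close> and of \<open>E^3 = (a + b + c + d)^3\<close> by their exponents modulo \<open>7\<close>. By Jacobi's
identity \<open>E^3\<close> has no terms in the classes \<open>2\<close>, \<open>4\<close>, \<open>5\<close>, \<open>6\<close>, and these four
vanishing sums are the relations between the parts of \<open>E\<close>.\<close>

theorem dissection_of_euler:
  fixes a b c d :: "7 fps"
  defines "a \<equiv> section7 0 euler" and "b \<equiv> section7 1 euler"
    and "c \<equiv> section7 2 euler" and "d \<equiv> section7 5 euler"
  shows "euler = a + b + c + d"
    and "section7 0 (euler ^ 2) = a^2 + 2*c*d" "section7 2 (euler ^ 2) = b^2 + 2*a*c"
       "section7 3 (euler ^ 2) = 2*b*c + d^2" "section7 4 (euler ^ 2) = c^2"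
    and "section7 0 (euler ^ 3) = a^3 + 3*b^2*d + 6*a*c*d"
       "section7 1 (euler ^ 3) = 3*a^2*b + 6*b*c*d + d^3"
       "section7 3 (euler ^ 3) = b^3 + 6*a*b*c + 3*a*d^2"
    and "a^2 * c + a * b^2 + c^2 * d = 0" "a * c^2 + b^2 * c + b * d^2 = 0"
       "a^2 * d + b * c^2 + c * d^2 = 0" "a * b * d = c^3"
proof -
  note E = section7_eq_0_outside[OF residues_in_euler, where ?'a = 7]
  note abcd = a_def[symmetric] b_def[symmetric, unfolded One_nat_def] c_def[symmetric] c_def[symmetric, unfolded numeral_2_eq_2] d_def[symmetric]
  note expand = section7_mult lessThan_7 E abcd
  show "euler = a + b + c + d"
    using sum_section7[of "euler :: 7 fps"] by (simp add: expand add_ac)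
  have sq: "section7 0 (euler ^ 2) = a^2 + 2*c*d" "section7 1 (euler ^ 2) = 2*a*b"
    "section7 2 (euler ^ 2) = b^2 + 2*a*c" "section7 3 (euler ^ 2) = 2*b*c + d^2"
    "section7 4 (euler ^ 2) = c^2" "section7 5 (euler ^ 2) = 2*a*d" "section7 6 (euler ^ 2) = 2*b*d"
    by (simp_all add: power2_eq_square expand algebra_simps)
  then show "section7 0 (euler ^ 2) = a^2 + 2*c*d" "section7 2 (euler ^ 2) = b^2 + 2*a*c"
       "section7 3 (euler ^ 2) = 2*b*c + d^2" "section7 4 (euler ^ 2) = c^2" by blast+
  have E3: "(euler ^ 3 :: 7 fps) = euler * euler ^ 2"
    by (simp add: power2_eq_square power3_eq_cube)
  have cu: "section7 0 (euler ^ 3) = a^3 + 3*b^2*d + 6*a*c*d"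
    "section7 1 (euler ^ 3) = 3*a^2*b + 6*b*c*d + d^3"
    "section7 2 (euler ^ 3) = 3 * (a^2 * c + a * b^2 + c^2 * d)"
    "section7 3 (euler ^ 3) = b^3 + 6*a*b*c + 3*a*d^2"
    "section7 4 (euler ^ 3) = 3 * (a * c^2 + b^2 * c + b * d^2)"
    "section7 5 (euler ^ 3) = 3 * (a^2 * d + b * c^2 + c * d^2)"
    "section7 6 (euler ^ 3) = 6 * (a * b * d) + c^3"
    unfolding E3 by (simp_all add: expand sq[unfolded One_nat_def] algebra_simps power2_eq_square power3_eq_cube)
  then show "section7 0 (euler ^ 3) = a^3 + 3*b^2*d + 6*a*c*d"
       "section7 1 (euler ^ 3) = 3*a^2*b + 6*b*c*d + d^3"
       "section7 3 (euler ^ 3) = b^3 + 6*a*b*c + 3*a*d^2" by blast+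
  have zero: "section7 r (euler ^ 3 :: 7 fps) = 0" if "r \<notin> {0, 1, 3}" for r
    by (rule section7_eq_0[OF residues_in_euler_cube that])
  \<comment> \<open>\<open>5\<close> is the inverse of \<open>3\<close> modulo \<open>7\<close>.\<close>
  have div3: "x = 0" if "3 * x = 0" for x :: "7 fps"
  proof -
    have "x = 5 * (3 * x) - 2 * 7 * x" by simp
    then show ?thesis using that seven_eq_0 by simp
  qed
  show "a^2 * c + a * b^2 + c^2 * d = 0"
    by (rule div3) (use cu(3) zero[of 2] in simp)
  show "a * c^2 + b^2 * c + b * d^2 = 0"
    by (rule div3) (use cu(5) zero[of 4] in simp)
  show "a^2 * d + b * c^2 + c * d^2 = 0"
    by (rule div3) (use cu(6) zero[of 5] in simp)
  have "6 * (a * b * d) + c^3 = 0"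
    using cu(7) zero[of 6] by simp
  moreover have "a * b * d = c^3 + 7 * (a * b * d) - (6 * (a * b * d) + c^3)" by simp
  ultimately show "a * b * d = c^3" using seven_eq_0 by simp
qed

section \<open>Sections of small powers\<close>

text \<open>These are Hecke eigenvalue equations modulo \<open>7\<close>; for instance the second one reflects that
\<open>\<eta>(6z)^4\<close> is an eigenform with eigenvalue \<open>-4\<close> at the prime \<open>7\<close>. They follow from the 7-dissection
through \<open>s = a^3 b + b^3 d + d^3 a + c^4\<close>: the section of \<open>E^4\<close> is \<open>4 s\<close> and that of \<open>E^5\<close> is \<open>3 c s\<close>.
The series \<open>s\<close> itself is determined by its square: \<open>s^2 = -c E^7 = (q E^28)^2\<close>, since
\<open>a^7 + b^7 + c^7 + d^7 = E^7\<close> and \<open>c = -q^2 E^49\<close>, and the sign is read off the leading coefficient.\<close>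

lemma section7_euler_powers:
  shows "section7 4 (euler ^ 2) = (fps_X ^ 4 * (euler ^ 14) ^ 7 :: 7 fps)"
    and "section7 1 (euler ^ 4) = (- 4 * fps_X * (euler ^ 4) ^ 7 :: 7 fps)"
    and "section7 3 (euler ^ 5) = (3 * fps_X ^ 3 * (euler ^ 11) ^ 7 :: 7 fps)"
proof -
  define a b c d where abcd: "a = section7 0 (euler :: 7 fps)" "b = section7 1 (euler :: 7 fps)"
    "c = section7 2 (euler :: 7 fps)" "d = section7 5 (euler :: 7 fps)"
  note E = section7_eq_0_outside[OF residues_in_euler, where ?'a = 7]
  have E3: "section7 r (euler ^ 3 :: 7 fps) = 0" if "r \<notin> {0, 1, 3}" for r
    by (rule section7_eq_0[OF residues_in_euler_cube that])
  note D = dissection_of_euler[folded abcd]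
  note unfold_Suc = abcd(2)[symmetric, unfolded One_nat_def] abcd(3)[symmetric, unfolded numeral_2_eq_2]
  define s where "s = a^3*b + b^3*d + d^3*a + c^4"
  have c: "c = - (fps_X ^ 2 * euler ^ 49)"
    unfolding abcd by (rule section7_2_euler)
  then show "section7 4 (euler ^ 2) = (fps_X ^ 4 * (euler ^ 14) ^ 7 :: 7 fps)"
    unfolding D(5) by (simp add: power_mult_distrib flip: power_mult)

  have s4: "section7 1 (euler ^ 4) = 4 * s"
  proof -
    have "section7 1 (euler * euler ^ 3 :: 7 fps) =
        a * (3*a^2*b + 6*b*c*d + d^3) + b * (a^3 + 3*b^2*d + 6*a*c*d) + d * (b^3 + 6*a*b*c + 3*a*d^2)"
      by (simp add: section7_mult lessThan_7 E E3 D(2-) abcd[symmetric] unfold_Suc D(7)[unfolded One_nat_def])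
    also have "\<dots> = 4 * s + 18 * c * (a * b * d - c^3) + 7 * (2 * c^4)"
      unfolding s_def by (simp add: algebra_simps power2_eq_square power3_eq_cube eval_nat_numeral)
    also have "\<dots> = 4 * s" by (simp add: D(12) seven_eq_0)
    finally show ?thesis by (simp add: power4_eq_xxxx power3_eq_cube mult.assoc)
  qed
  have s5: "section7 3 (euler ^ 5) = 3 * c * s"
  proof -
    have "section7 3 (euler ^ 2 * euler ^ 3 :: 7 fps) =
        (2*b*c + d^2) * (a^3 + 3*b^2*d + 6*a*c*d) + (b^2 + 2*a*c) * (3*a^2*b + 6*b*c*d + d^3)
         + (a^2 + 2*c*d) * (b^3 + 6*a*b*c + 3*a*d^2)"
      by (subst section7_mult) (simp_all add: lessThan_7 E3 D(2-) D(7)[unfolded One_nat_def])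
    also have "\<dots> = 3 * c * s"
      unfolding s_def by (rule quintic_identity[OF D(9-12) seven_eq_0])
    finally show ?thesis by (simp flip: power_add)
  qed
  have sq: "s ^ 2 = (fps_X * euler ^ 28) ^ 2"
  proof -
    have "s ^ 2 = - c * (a^7 + b^7 + c^7 + d^7)"
      unfolding s_def by (rule octic_identity[OF D(9-12) seven_eq_0])
    also have "a^7 + b^7 + c^7 + d^7 = (a + b + c + d) ^ 7"
      by (simp add: freshmans_dream)
    also have "\<dots> = euler ^ 7" unfolding D(1) ..
    also have "- c * euler ^ 7 = (fps_X * euler ^ 28) ^ 2"
      unfolding c by (simp add: power_mult_distrib mult.assoc flip: power_mult power_add)
    finally show ?thesis .
  qed
  have s: "s = - (fps_X * euler ^ 28)"
  proof -
    \<comment> \<open>Both square roots \<open>\<plusminus> q E^28\<close> start in degree \<open>1\<close>, so the coefficient there decides.\<close>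
    have euler01: "euler $ 0 = (1::7)" "euler $ Suc 0 = (-1::7)"
      by (simp_all add: euler_def euler_poly_def)
    have "trunc_eq 2 a 1" "trunc_eq 2 b (- fps_X)" "trunc_eq 2 c 0" "trunc_eq 2 d 0"
      by (auto simp: trunc_eq_def abcd euler01 less_2_cases_iff)
    then have "trunc_eq 2 s (1^3 * (- fps_X) + (- fps_X)^3 * 0 + 0^3 * 1 + 0^4)"
      unfolding s_def by (intro trunc_eq_add trunc_eq_mult trunc_eq_power)
    then have s01: "s $ 0 = 0" "s $ 1 = -1"
      by (simp_all add: trunc_eq_def)
    have "(fps_X * euler ^ 28 :: 7 fps) $ 0 = 0" "(fps_X * euler ^ 28 :: 7 fps) $ 1 = 1"
      by (simp_all add: fps_nth_power_0 euler01)
    \<comment> \<open>The difference has leading coefficient \<open>-2\<close>, whose inverse modulo \<open>7\<close> is \<open>3\<close>.\<close>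
    with s01 have "(s - fps_X * euler ^ 28) $ 0 = 0" "(s - fps_X * euler ^ 28) $ 1 * 3 = 1"
      by simp_all
    moreover have "(s - fps_X * euler ^ 28) * (s + fps_X * euler ^ 28) = 0"
      using sq by (simp add: algebra_simps power2_eq_square)
    ultimately have "s + fps_X * euler ^ 28 = 0"
      by (rule fps_mult_eq_0_imp)
    then show ?thesis by (rule eq_neg_iff_add_eq_0[THEN iffD2])
  qed
  show "section7 1 (euler ^ 4) = (- 4 * fps_X * (euler ^ 4) ^ 7 :: 7 fps)"
    unfolding s4 s by (simp flip: power_mult)
  show "section7 3 (euler ^ 5) = (3 * fps_X ^ 3 * (euler ^ 11) ^ 7 :: 7 fps)"
    unfolding s5 s c by (simp add: mult_ac flip: power_mult power_add) (simp add: power_add power2_eq_square power3_eq_cube mult_ac)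
qed

lemma extract7_euler_powers:
  shows "extract7 4 (euler ^ 2) = (euler ^ 14 :: 7 fps)"
    and "extract7 1 (euler ^ 4) = (fps_const (- 4) * euler ^ 4 :: 7 fps)"
    and "extract7 3 (euler ^ 5) = (fps_const 3 * euler ^ 11 :: 7 fps)"
proof -
  show "extract7 4 (euler ^ 2) = (euler ^ 14 :: 7 fps)"
    using extract7_eq_of_section7[of 4 "euler ^ 2" 1 "euler ^ 14"] section7_euler_powers(1) by simp
  show "extract7 1 (euler ^ 4) = (fps_const (- 4) * euler ^ 4 :: 7 fps)"
    using section7_euler_powers(2)
    by (intro extract7_eq_of_section7) (simp_all add: numeral_fps_const flip: fps_const_neg)
  show "extract7 3 (euler ^ 5) = (fps_const 3 * euler ^ 11 :: 7 fps)"
    using section7_euler_powers(3)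
    by (intro extract7_eq_of_section7) (simp_all add: numeral_fps_const)
qed

section \<open>The congruences\<close>

definition inv_euler :: "7 fps" where "inv_euler = colour_partitions_fps 1"

lemma euler_mult_inverse: "euler * inv_euler = 1"
  using colour_partitions_fps_mult_euler[of 1, where ?'a = 7] by (simp add: inv_euler_def mult.commute)

text \<open>Completing \<open>r\<close> to a multiple of \<open>7\<close> trades the negative power \<open>E^(-r)\<close> for a small positive
power of \<open>E\<close> and a series in \<open>q^7\<close>.\<close>

lemma colour_partitions_fps_eq:
  assumes "r + e = 7 * t"
  shows "colour_partitions_fps r = euler ^ e * (inv_euler ^ t) ^ 7"
proof -
  have 1: "euler ^ r * inv_euler ^ r = 1"
    using euler_mult_inverse by (simp flip: power_mult_distrib)
  have 2: "euler ^ e * inv_euler ^ e = 1"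
    using euler_mult_inverse by (simp flip: power_mult_distrib)
  have "colour_partitions_fps r = (colour_partitions_fps r * euler ^ r) * inv_euler ^ r"
    using 1 by (simp add: mult.assoc)
  also have "\<dots> = inv_euler ^ r" by (simp add: colour_partitions_fps_mult_euler)
  also have "\<dots> = (euler ^ e * inv_euler ^ e) * inv_euler ^ r" using 2 by simp
  also have "\<dots> = euler ^ e * inv_euler ^ (r + e)" by (simp only: power_add mult_ac)
  also have "\<dots> = euler ^ e * (inv_euler ^ t) ^ 7" using assms by (simp add: mult.commute flip: power_mult)
  finally show ?thesis .
qed

lemma num_colour_partitions_cong_0:
  assumes "(colour_partitions_fps r :: 7 fps) $ n = 0"
  shows "[num_colour_partitions r n = 0] (mod 7)"
proof -
  have "of_nat (num_colour_partitions r n) = (0 :: 7)"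
    using assms by (simp add: colour_partitions_fps_def)
  then have "7 dvd num_colour_partitions r n"
    by (metis CHAR_7(1) of_nat_eq_0_iff_char_dvd)
  then show ?thesis by (simp add: cong_0_iff)
qed

lemma residues_in_mult_power7:
  "residues_in R f \<Longrightarrow> R \<subseteq> {..<7} \<Longrightarrow> residues_in R (f * g ^ 7 :: 7 fps)"
  by (rule residues_in_mult[OF _ residues_in_power7]) auto

lemma residues_in_const_mult: "residues_in R f \<Longrightarrow> residues_in R (fps_const c * f :: 'a::comm_ring_1 fps)"
  unfolding residues_in_def fps_mult_left_const_nth by (metis mult_zero_right)

lemma residues_in_euler_6: "residues_in {0, 1, 2, 3, 4, 6} (euler ^ 6 :: 7 fps)"
proof -
  have "residues_in {0, 1, 2, 3, 4, 6} (euler ^ 3 * euler ^ 3 :: 7 fps)"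
    by (rule residues_in_mult[OF residues_in_euler_cube residues_in_euler_cube]) auto
  then show ?thesis by (simp flip: power_add)
qed

theorem theorem1p2:
  fixes k n :: nat
  shows "[num_colour_partitions (7 * k + 1) (7 * n + 5) = 0] (mod 7)
    \<and> (\<forall>j \<in> {2, 4, 5, 6}. [num_colour_partitions (7 * k + 4) (7 * n + j) = 0] (mod 7))
    \<and> (\<forall>j \<in> {3, 4, 6}. [num_colour_partitions (7 * k + 6) (7 * n + j) = 0] (mod 7))
    \<and> (\<forall>j \<in> {2, 4, 5, 6}. [num_colour_partitions (49 * k + 2) (49 * n + 7 * j + 3) = 0] (mod 7))
    \<and> (\<forall>j \<in> {2, 4, 5, 6}. [num_colour_partitions (49 * k + 3) (49 * n + 7 * j + 1) = 0] (mod 7))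
    \<and> [num_colour_partitions (49 * k + 5) (49 * n + 39) = 0] (mod 7)"
proof (intro conjI ballI; rule num_colour_partitions_cong_0)
  let ?I = "inv_euler ^ (k + 1)"
  have split: "(inv_euler ^ (7 * (k + 1))) = ?I ^ 7"
    by (simp only: mult.commute[of 7] power_mult)
  have cube: "residues_in {0, 1, 3} (euler ^ 3 * g ^ 7 :: 7 fps)" for g
    by (rule residues_in_mult_power7[OF residues_in_euler_cube]) auto
  have sixth: "residues_in {0, 1, 2, 3, 4, 6} (euler ^ 6 * g ^ 7 :: 7 fps)" for g
    by (rule residues_in_mult_power7[OF residues_in_euler_6]) auto
  have first: "residues_in {0, 1, 2, 5} (euler * g ^ 7 :: 7 fps)" for g
    by (rule residues_in_mult_power7[OF residues_in_euler]) auto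
  have single: "colour_partitions_fps (7 * k + s) = euler ^ e * ?I ^ 7" if "s + e = 7" for s e
    by (rule colour_partitions_fps_eq) (use that in simp)
  show "(colour_partitions_fps (7 * k + 1) :: 7 fps) $ (7 * n + 5) = 0"
    using residues_in_nth_eq_0[OF sixth[of ?I], of "7 * n + 5"] single[of 1 6] by simp
  show "(colour_partitions_fps (7 * k + 4) :: 7 fps) $ (7 * n + j) = 0" if "j \<in> {2, 4, 5, 6}" for j
    using residues_in_nth_eq_0[OF cube[of ?I], of "7 * n + j"] single[of 4 3] that by auto
  show "(colour_partitions_fps (7 * k + 6) :: 7 fps) $ (7 * n + j) = 0" if "j \<in> {3, 4, 6}" for j
    using residues_in_nth_eq_0[OF first[of ?I], of "7 * n + j"] single[of 6 1] that by auto
  have reduce: "extract7 r (colour_partitions_fps (49 * k + s)) =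
      extract7 r (euler ^ e) * (euler ^ 6 * ?I ^ 7)" if "s + e = 7" "r < 7" for r s e
  proof -
    have "colour_partitions_fps (49 * k + s) = euler ^ (e + 42) * (inv_euler ^ (7 * (k + 1))) ^ 7"
      by (rule colour_partitions_fps_eq) (use that in simp)
    also have "\<dots> = euler ^ e * (euler ^ 6 * ?I ^ 7) ^ 7"
      unfolding split by (simp add: power_add power_mult_distrib mult.assoc flip: power_mult)
    finally show ?thesis using that(2) by (simp only: extract7_mult_power7)
  qed
  \<comment> \<open>Each section of a small power is a constant times \<open>E^m\<close> with \<open>m + 6 \<equiv> 3\<close> or \<open>m + 6 \<equiv> 6\<close> modulo
    \<open>7\<close>, so one is back at the cube or the sixth power times a series in \<open>q^7\<close>.\<close>
  have regroup: "z * x ^ m * (x ^ 6 * y ^ 7) = z * (x ^ i * (x ^ l * y) ^ 7)" if "m + 6 = i + 7 * l"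
    for x y z :: "7 fps" and m i l
  proof -
    have "x ^ m * x ^ 6 = x ^ i * (x ^ l) ^ 7"
      using that by (simp add: mult.commute[of l] flip: power_add power_mult)
    then have "z * (x ^ m * x ^ 6) * y ^ 7 = z * (x ^ i * (x ^ l) ^ 7) * y ^ 7" by simp
    then show ?thesis by (simp only: power_mult_distrib mult.assoc)
  qed
  show "(colour_partitions_fps (49 * k + 2) :: 7 fps) $ (49 * n + 7 * j + 3) = 0" if "j \<in> {2, 4, 5, 6}" for j
  proof -
    have "extract7 3 (colour_partitions_fps (49 * k + 2)) = fps_const 3 * (euler ^ 3 * (euler ^ 2 * ?I) ^ 7)"
      using reduce[of 2 5 3] regroup[where z = "fps_const 3" and x = euler and m = 11 and y = ?I and i = 3 and l = 2]
      by (simp only: extract7_euler_powers power_one_right mult_1_left)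
    moreover have "residues_in {0, 1, 3} \<dots>"
      by (intro residues_in_const_mult cube)
    ultimately have "residues_in {0, 1, 3} (extract7 3 (colour_partitions_fps (49 * k + 2) :: 7 fps))"
      by (simp only:)
    then have "extract7 3 (colour_partitions_fps (49 * k + 2) :: 7 fps) $ (7 * n + j) = 0"
      by (rule residues_in_nth_eq_0) (use that in auto)
    then show ?thesis by (simp add: algebra_simps)
  qed
  show "(colour_partitions_fps (49 * k + 3) :: 7 fps) $ (49 * n + 7 * j + 1) = 0" if "j \<in> {2, 4, 5, 6}" for j
  proof -
    have "extract7 1 (colour_partitions_fps (49 * k + 3)) = fps_const (- 4) * (euler ^ 3 * (euler * ?I) ^ 7)"
      using reduce[of 3 4 1] regroup[where z = "fps_const (- 4)" and x = euler and m = 4 and y = ?I and i = 3 and l = 1]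
      by (simp only: extract7_euler_powers power_one_right mult_1_left)
    moreover have "residues_in {0, 1, 3} \<dots>"
      by (intro residues_in_const_mult cube)
    ultimately have "residues_in {0, 1, 3} (extract7 1 (colour_partitions_fps (49 * k + 3) :: 7 fps))"
      by (simp only:)
    then have "extract7 1 (colour_partitions_fps (49 * k + 3) :: 7 fps) $ (7 * n + j) = 0"
      by (rule residues_in_nth_eq_0) (use that in auto)
    then show ?thesis by (simp add: algebra_simps)
  qed
  show "(colour_partitions_fps (49 * k + 5) :: 7 fps) $ (49 * n + 39) = 0"
  proof -
    have "extract7 4 (colour_partitions_fps (49 * k + 5)) = euler ^ 6 * (euler ^ 2 * ?I) ^ 7"
      using reduce[of 5 2 4] regroup[where z = 1 and x = euler and m = 14 and y = ?I and i = 6 and l = 2]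
      by (simp only: extract7_euler_powers power_one_right mult_1_left)
    moreover have "residues_in {0, 1, 2, 3, 4, 6} \<dots>"
      by (rule sixth)
    ultimately have "residues_in {0, 1, 2, 3, 4, 6} (extract7 4 (colour_partitions_fps (49 * k + 5) :: 7 fps))"
      by (simp only:)
    then have "extract7 4 (colour_partitions_fps (49 * k + 5) :: 7 fps) $ (7 * n + 5) = 0"
      by (rule residues_in_nth_eq_0) auto
    then show ?thesis by (simp add: algebra_simps)
  qed
qed

end
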